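(* Let $(A,\succ_\lambda,\prec_\lambda)$ be a finite dendriform conformal algebra which is free as a $\mathbb{C}[\partial]$-module. Then $$r=\sum_{i=1}^n(e_i\otimes e_i^\ast-e_i^\ast\otimes e_i)$$ is a solution of the associative conformal Yang-Baxter equation in the associative conformal algebra $A\ltimes_{R_\prec^\ast,L_\succ^\ast}A^{\ast c}$, where $A$ carries its associated associative conformal algebra structure $\ast_\lambda$, $\{e_1,\dots,e_n\}$ is a $\mathbb{C}[\partial]$-basis of $A$ and $\{e_1^\ast,\dots,e_n^\ast\}$ is the dual $\mathbb{C}[\partial]$-basis of $A^{\ast c}$.
   Context: Everything is over $\mathbb{C}$. An associative conformal algebra is a $\mathbb{C}[\partial]$-module $B$ with a $\mathbb{C}$-bilinear map $B\times B\to B[\lambda]$, $(a,b)\mapsto a_\lambda b$, such that $(\partial a)_\lambda b=-\lambda a_\lambda b$, $a_\lambda(\partial b)=(\partial+\lambda)(a_\lambda b)$ and $(a_\lambda b)_{\lambda+\mu}c=a_\lambda(b_\mu c)$. Finite means finitely generated as a $\mathbb{C}[\partial]$-module. A dendriform conformal algebra is a $\mathbb{C}[\partial]$-module $A$ with two $\mathbb{C}$-bilinear products $\prec_\lambda,\succ_\lambda:A\times A\to A[\lambda]$ such that for all $a,b,c\in A$, with $a\ast_\lambda b=a\prec_\lambda b+a\succ_\lambda b$: $(\partial a)\succ_\lambda b=-\lambda\, a\succ_\lambda b$, $a\succ_\lambda(\partial b)=(\partial+\lambda)(a\succ_\lambda b)$, $(\partial a)\prec_\lambda b=-\lambda\,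 a\prec_\lambda b$, $a\prec_\lambda(\partial b)=(\partial+\lambda)(a\prec_\lambda b)$, $(a\prec_\lambda b)\prec_{\lambda+\mu}c=a\prec_\lambda(b\ast_\mu c)$, $(a\succ_\lambda b)\prec_{\lambda+\mu}c=a\succ_\lambda(b\prec_\mu c)$, $a\succ_\lambda(b\succ_\mu c)=(a\ast_\lambda b)\succ_{\lambda+\mu}c$. The associated associative conformal algebra is $(A,\ast_\lambda)$. Convention: a subscript $-\lambda-\partial$ on an operation means: expand in powers of the subscript variable $\nu$ and replace $\nu^k$ by $(-\lambda-\partial)^k$, $\partial$ acting on the coefficients. Set $L_\succ(a)_\lambda b=a\succ_\lambda b$, $R_\prec(a)_\lambda b=b\prec_{-\lambda-\partial}a$. The conformal dual $A^{\ast c}$ is the space of $\mathbb{C}$-linear maps $f:A\to\mathbb{C}[\lambda]$, $a\mapsto f_\lambda(a)$, with $f_\lambda(\partial a)=\lambda f_\lambda(a)$; it is a $\mathbb{C}[\partial]$-module via $(\partial f)_\lambda=-\lambda f_\lambda$. The dual basis satisfies $(e_j^\ast)_\lambda(e_i)=\delta_{ij}$. Define $(L_\succ^\ast(a)_\lambda f)_\mu b=f_{\mu-\lambda}(L_\succ(a)_\lambda b)$ and $(R_\prec^\ast(a)_\lambda f)_\mu b=f_{\mu-\lambda}(R_\prec(a)_\lambda b)$. $A\ltimes_{R_\prec^\ast,L_\succ^\ast}A^{\ast c}$ is the associative conformal algebra on $A\oplus A^{\ast c}$ with $(a+f)_\lambda(b+g)=a\ast_\lambda b+R_\prec^\ast(a)_\lambda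 g+L_\succ^\ast(b)_{-\lambda-\partial}f$. For an associative conformal algebra $B$ and $r=\sum_ir_i\otimes l_i\in B\otimes B$, put $\partial^{\otimes^2}=\partial\otimes1+1\otimes\partial$, $\partial^{\otimes^3}=\partial\otimes1\otimes1+1\otimes\partial\otimes1+1\otimes1\otimes\partial$ and $$r\bullet r=\sum_{i,j}\Big(r_i\otimes r_j\otimes{l_i}_\mu l_j\big|_{\mu=\partial\otimes1\otimes1}-r_i\otimes{r_j}_\mu l_i\otimes l_j\big|_{\mu=-\partial^{\otimes^2}\otimes1}+{r_i}_\mu r_j\otimes l_i\otimes l_j\big|_{\mu=1\otimes\partial\otimes1}\Big),$$ where powers of $\mu$ are replaced by powers of the operator acting on the coefficients in $B^{\otimes3}$. The associative conformal Yang-Baxter equation in $B$ is $r\bullet r\equiv0\ \mathrm{mod}\ (\partial^{\otimes^3})$, i.e. $r\bullet r\in\partial^{\otimes^3}(B\otimes B\otimes B)$. *)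

theory Defs
  imports Complex_Main
    "HOL-Computational_Algebra.Polynomial"
    "HOL-Library.Poly_Mapping"
    "HOL-Library.Product_Plus"
begin

section \<open>Complex vector spaces and \<open>\<complex>[\<partial>]\<close>-modules\<close>

class complex_vector = ab_group_add +
  fixes scaleC :: "complex \<Rightarrow> 'a \<Rightarrow> 'a"  (infixr "*\<^sub>C" 75)
  assumes scaleC_add_right: "c *\<^sub>C (x + y) = c *\<^sub>C x + c *\<^sub>C y"
    and scaleC_add_left: "(c + d) *\<^sub>C x = c *\<^sub>C x + d *\<^sub>C x"
    and scaleC_scaleC: "c *\<^sub>C d *\<^sub>C x = (c * d) *\<^sub>C x"
    and scaleC_one: "1 *\<^sub>C x = x"

interpretation complex_vector: vector_space "(*\<^sub>C) :: complex \<Rightarrow> 'a \<Rightarrow> 'a::complex_vector"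
  by unfold_locales (simp_all add: scaleC_add_right scaleC_add_left scaleC_scaleC scaleC_one)

abbreviation clinear :: "('a::complex_vector \<Rightarrow> 'b::complex_vector) \<Rightarrow> bool" where
  "clinear f \<equiv> Vector_Spaces.linear (*\<^sub>C) (*\<^sub>C) f"

lemma clinear_iff:
  "clinear f \<longleftrightarrow> (\<forall>x y. f (x + y) = f x + f y) \<and> (\<forall>c x. f (c *\<^sub>C x) = c *\<^sub>C f x)"
  by (simp add: Vector_Spaces.linear_def module_hom_def module_hom_axioms_def
      complex_vector.vector_space_axioms complex_vector.module_axioms)

text \<open>A \<open>\<complex>[\<partial>]\<close>-module is a complex vector space with a linear operator \<open>\<partial>\<close>; the action
  of a polynomial in \<open>\<partial>\<close> is \<open>pact\<close> below.\<close>

class cd_module = complex_vector +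
  fixes cderiv :: "'a \<Rightarrow> 'a"  ("\<partial>")
  assumes cderiv_add: "\<partial> (x + y) = \<partial> x + \<partial> y"
    and cderiv_scaleC: "\<partial> (c *\<^sub>C x) = c *\<^sub>C \<partial> x"

lemma clinear_cderiv: "clinear (\<partial> :: 'a \<Rightarrow> 'a::cd_module)"
  by (simp add: clinear_iff cderiv_add cderiv_scaleC)

lemma cderiv_0 [simp]: "\<partial> (0 :: 'a::cd_module) = 0"
  using cderiv_scaleC[of 0 0] by simp

text \<open>\<open>subst_op T j p\<close> replaces the powers \<open>\<nu>\<^sup>k\<close> of the variable of \<open>p = \<Sum>\<^sub>k c\<^sub>k \<nu>\<^sup>k\<close> by the
  powers \<open>T\<^sup>k\<close> of an operator, acting on the images \<open>j c\<^sub>k\<close> of the coefficients.\<close>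

definition subst_op :: "('m \<Rightarrow> 'm) \<Rightarrow> ('c \<Rightarrow> 'm) \<Rightarrow> 'c::zero poly \<Rightarrow> 'm::comm_monoid_add" where
  "subst_op T j p = (\<Sum>k\<le>degree p. (T ^^ k) (j (coeff p k)))"

lemma additive_funpow:
  fixes T :: "'m::comm_monoid_add \<Rightarrow> 'm"
  assumes "\<And>x y. T (x + y) = T x + T y"
  shows "(T ^^ k) (x + y) = (T ^^ k) x + (T ^^ k) y"
  using assms by (induction k) simp_all

lemma additive_0:
  fixes f :: "'m::ab_group_add \<Rightarrow> 'n::ab_group_add"
  assumes "\<And>x y. f (x + y) = f x + f y"
  shows "f 0 = 0"
  using assms[of 0 0] by simp

lemma zero_funpow:
  fixes T :: "'m::zero \<Rightarrow> 'm"
  shows "T 0 = 0 \<Longrightarrow> (T ^^ k) 0 = 0"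
  by (induction k) simp_all

lemma subst_op_bound:
  assumes "T 0 = 0" "j 0 = 0" "degree p \<le> N"
  shows "subst_op T j p = (\<Sum>k\<le>N. (T ^^ k) (j (coeff p k)))"
  unfolding subst_op_def
  using assms by (intro sum.mono_neutral_left) (auto simp: coeff_eq_0 zero_funpow)

lemma subst_op_0 [simp]: "j 0 = 0 \<Longrightarrow> subst_op T j 0 = j 0"
  by (simp add: subst_op_def)

lemma subst_op_add:
  fixes T :: "'m::ab_group_add \<Rightarrow> 'm" and j :: "'c::ab_group_add \<Rightarrow> 'm"
  assumes T: "\<And>x y. T (x + y) = T x + T y" and j: "\<And>x y. j (x + y) = j x + j y"
  shows "subst_op T j (p + q) = subst_op T j p + subst_op T j q"
proof -
  let ?N = "max (degree p) (degree q)"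
  have T0: "T 0 = 0" and j0: "j 0 = 0" using additive_0 T j by blast+
  have "degree (p + q) \<le> ?N" by (rule degree_add_le_max)
  then show ?thesis
    by (simp add: subst_op_bound[where T = T and j = j and N = ?N, OF T0 j0] j additive_funpow[OF T] sum.distrib)
qed

lemma subst_op_pCons:
  fixes T :: "'m::ab_group_add \<Rightarrow> 'm" and j :: "'c::ab_group_add \<Rightarrow> 'm"
  assumes T: "\<And>x y. T (x + y) = T x + T y" and j: "\<And>x y. j (x + y) = j x + j y"
  shows "subst_op T j (pCons a p) = j a + T (subst_op T j p)"
proof -
  have T0: "T 0 = 0" and j0: "j 0 = 0" using additive_0 T j by blast+
  have sum: "T (sum f A) = (\<Sum>x\<in>A. T (f x))" if "finite A" for f :: "nat \<Rightarrow> 'm" and A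
    using that by (induction A rule: finite_induct) (simp_all add: T T0)
  have "subst_op T j (pCons a p) = (\<Sum>k\<le>Suc (degree p). (T ^^ k) (j (coeff (pCons a p) k)))"
    by (rule subst_op_bound[where T = T and j = j, OF T0 j0]) (rule degree_pCons_le)
  also have "\<dots> = j a + (\<Sum>k\<le>degree p. (T ^^ Suc k) (j (coeff p k)))"
    by (subst sum.atMost_Suc_shift) simp
  also have "(\<Sum>k\<le>degree p. (T ^^ Suc k) (j (coeff p k))) = T (subst_op T j p)"
    by (simp add: subst_op_def sum)
  finally show ?thesis .
qed

definition pact :: "complex poly \<Rightarrow> 'a::cd_module \<Rightarrow> 'a" where
  "pact p x = subst_op \<partial> (\<lambda>c. c *\<^sub>C x) p"

lemma pact_pCons: "pact (pCons c p) x = c *\<^sub>C x + \<partial> (pact p x)"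
  unfolding pact_def by (rule subst_op_pCons) (simp_all add: cderiv_add scaleC_add_left)

lemma pact_0 [simp]: "pact 0 x = 0"
  by (simp add: pact_def subst_op_def)

lemma pact_add_left: "pact (p + q) x = pact p x + pact q x"
  unfolding pact_def by (rule subst_op_add) (simp_all add: cderiv_add scaleC_add_left)

lemma pact_add_right: "pact p (x + y) = pact p x + pact p y"
  by (induction p) (simp_all add: pact_pCons scaleC_add_right cderiv_add)

lemma pact_smult: "pact (smult c p) x = c *\<^sub>C pact p x"
  by (induction p) (simp_all add: pact_pCons scaleC_add_right scaleC_scaleC cderiv_scaleC)

lemma pact_mult: "pact p (pact q x) = pact (p * q) x"
  by (induction p) (simp_all add: pact_pCons pact_add_left pact_smult)

interpretation cd_module: module "pact :: complex poly \<Rightarrow> 'a \<Rightarrow> 'a::cd_module"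
  by unfold_locales
    (simp_all add: pact_add_left pact_add_right pact_mult one_pCons pact_pCons scaleC_one)

definition cd_basis :: "nat \<Rightarrow> (nat \<Rightarrow> 'a::cd_module) \<Rightarrow> bool" where
  "cd_basis n e \<longleftrightarrow> inj_on e {1..n} \<and> cd_module.independent (e ` {1..n}) \<and>
    cd_module.span (e ` {1..n}) = UNIV"

text \<open>\<open>M[\<lambda>]\<close> is \<open>'m poly\<close>, with \<open>\<partial>\<close> acting on the coefficients.\<close>

instantiation poly :: (complex_vector) complex_vector
begin
definition scaleC_poly :: "complex \<Rightarrow> 'a poly \<Rightarrow> 'a poly" where
  "scaleC_poly c = map_poly (scaleC c)"
instance
  by standard (simp_all add: scaleC_poly_def poly_eq_iff coeff_map_poly
      scaleC_add_right scaleC_add_left scaleC_scaleC scaleC_one)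
end

lemma coeff_scaleC [simp]: "coeff (c *\<^sub>C p) k = c *\<^sub>C coeff p k"
  by (simp add: scaleC_poly_def coeff_map_poly)

instantiation poly :: (cd_module) cd_module
begin
definition cderiv_poly :: "'a poly \<Rightarrow> 'a poly" where
  "cderiv_poly = map_poly \<partial>"
instance
  by standard (simp_all add: cderiv_poly_def poly_eq_iff coeff_map_poly cderiv_add cderiv_scaleC)
end

lemma coeff_cderiv [simp]: "coeff (\<partial> p) k = \<partial> (coeff p k)"
  by (simp add: cderiv_poly_def coeff_map_poly)

instantiation prod :: (complex_vector, complex_vector) complex_vector
begin
definition scaleC_prod :: "complex \<Rightarrow> 'a \<times> 'b \<Rightarrow> 'a \<times> 'b" where
  "scaleC_prod c x = (c *\<^sub>C fst x, c *\<^sub>C snd x)"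
instance
  by standard (simp_all add: scaleC_prod_def prod_eq_iff
      scaleC_add_right scaleC_add_left scaleC_scaleC scaleC_one)
end

instantiation prod :: (cd_module, cd_module) cd_module
begin
definition cderiv_prod :: "'a \<times> 'b \<Rightarrow> 'a \<times> 'b" where
  "cderiv_prod x = (\<partial> (fst x), \<partial> (snd x))"
instance
  by standard (simp_all add: cderiv_prod_def scaleC_prod_def cderiv_add cderiv_scaleC)
end

section \<open>Conformal algebras\<close>

definition conformal_product :: "('a::cd_module \<Rightarrow> 'a \<Rightarrow> 'a poly) \<Rightarrow> bool" where
  "conformal_product m \<longleftrightarrow>
    (\<forall>a. clinear (\<lambda>b. m a b)) \<and> (\<forall>b. clinear (\<lambda>a. m a b)) \<and>
    (\<forall>a b. m (\<partial> a) b = - pCons 0 (m a b)) \<and>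
    (\<forall>a b. m a (\<partial> b) = \<partial> (m a b) + pCons 0 (m a b))"

text \<open>\<open>M[\<lambda>, \<mu>]\<close> is \<open>'m poly poly\<close>, where \<open>\<lambda>\<close> is the outer and \<open>\<mu>\<close> the inner variable.\<close>

definition times_lambda :: "'m::ab_group_add poly poly \<Rightarrow> 'm poly poly" where
  "times_lambda P = pCons 0 P"

definition times_mu :: "'m::ab_group_add poly poly \<Rightarrow> 'm poly poly" where
  "times_mu P = map_poly (pCons 0) P"

text \<open>\<open>nest_left p q a b c\<close> is \<open>(a p\<^sub>\<lambda> b) q\<^bsub>\<lambda>+\<mu>\<^esub> c\<close>, and \<open>nest_right p q a b c\<close> is
  \<open>a p\<^sub>\<lambda> (b q\<^sub>\<mu> c)\<close>.\<close>

definition nest_left ::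
  "('a \<Rightarrow> 'a \<Rightarrow> 'a poly) \<Rightarrow> ('a \<Rightarrow> 'a \<Rightarrow> 'a poly) \<Rightarrow> 'a \<Rightarrow> 'a \<Rightarrow> 'a \<Rightarrow> 'a::ab_group_add poly poly" where
  "nest_left p q a b c =
    subst_op times_lambda
      (\<lambda>d. subst_op (\<lambda>P. times_lambda P + times_mu P) (\<lambda>x. [:[:x:]:]) (q d c)) (p a b)"

definition nest_right ::
  "('a \<Rightarrow> 'a \<Rightarrow> 'a poly) \<Rightarrow> ('a \<Rightarrow> 'a \<Rightarrow> 'a poly) \<Rightarrow> 'a \<Rightarrow> 'a \<Rightarrow> 'a \<Rightarrow> 'a::ab_group_add poly poly" where
  "nest_right p q a b c =
    subst_op times_mu (\<lambda>d. subst_op times_lambda (\<lambda>x. [:[:x:]:]) (p a d)) (q b c)"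

definition assoc_conformal_algebra :: "('a::cd_module \<Rightarrow> 'a \<Rightarrow> 'a poly) \<Rightarrow> bool" where
  "assoc_conformal_algebra m \<longleftrightarrow>
    conformal_product m \<and> (\<forall>a b c. nest_left m m a b c = nest_right m m a b c)"

definition star_product ::
  "('a \<Rightarrow> 'a \<Rightarrow> 'a poly) \<Rightarrow> ('a \<Rightarrow> 'a \<Rightarrow> 'a poly) \<Rightarrow> 'a \<Rightarrow> 'a \<Rightarrow> 'a::ab_group_add poly" where
  "star_product prec succ a b = prec a b + succ a b"

definition dendriform_conformal_algebra ::
  "('a::cd_module \<Rightarrow> 'a \<Rightarrow> 'a poly) \<Rightarrow> ('a \<Rightarrow> 'a \<Rightarrow> 'a poly) \<Rightarrow> bool" where
  "dendriform_conformal_algebra prec succ \<longleftrightarrow>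
    conformal_product succ \<and> conformal_product prec \<and>
    (\<forall>a b c. nest_left prec prec a b c = nest_right prec (star_product prec succ) a b c) \<and>
    (\<forall>a b c. nest_left succ prec a b c = nest_right succ prec a b c) \<and>
    (\<forall>a b c. nest_right succ succ a b c = nest_left (star_product prec succ) succ a b c)"

lemma times_lambda_add: "times_lambda (P + Q) = times_lambda P + times_lambda Q"
  by (simp add: times_lambda_def)

lemma times_mu_add: "times_mu (P + Q) = times_mu P + times_mu Q"
  by (simp add: times_mu_def poly_eq_iff coeff_map_poly)

lemma nest_left_add_left:
  assumes "conformal_product q"
  shows "nest_left (star_product p p') q a b c = nest_left p q a b c + nest_left p' q a b c"
proof -
  let ?s = "subst_op (\<lambda>P. times_lambda P + times_mu P) (\<lambda>x::'a. [:[:x:]:])"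
  have s: "?s (x + y) = ?s x + ?s y" for x y
    by (rule subst_op_add) (simp_all add: times_lambda_add times_mu_add)
  have q: "q (x + y) c = q x c + q y c" for x y
    using assms by (simp add: conformal_product_def clinear_iff)
  show ?thesis
    unfolding nest_left_def star_product_def
    by (rule subst_op_add) (simp_all add: times_lambda_add q s)
qed

lemma nest_left_add_right:
  "nest_left p (star_product q q') a b c = nest_left p q a b c + nest_left p q' a b c"
proof -
  let ?s = "subst_op (\<lambda>P. times_lambda P + times_mu P) (\<lambda>x::'a. [:[:x:]:])"
  have s: "?s (x + y) = ?s x + ?s y" for x y
    by (rule subst_op_add) (simp_all add: times_lambda_add times_mu_add)
  have "(times_lambda ^^ k) (x + y) = (times_lambda ^^ k) x + (times_lambda ^^ k) y"
    for k and x y :: "'a poly poly"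
    by (rule additive_funpow) (rule times_lambda_add)
  then show ?thesis
    by (simp add: nest_left_def star_product_def s subst_op_def[of times_lambda] sum.distrib)
qed

lemma nest_right_add_right:
  assumes "conformal_product p"
  shows "nest_right p (star_product q q') a b c = nest_right p q a b c + nest_right p q' a b c"
proof -
  let ?s = "subst_op times_lambda (\<lambda>x::'a. [:[:x:]:])"
  have s: "?s (x + y) = ?s x + ?s y" for x y
    by (rule subst_op_add) (simp_all add: times_lambda_add)
  have p: "p a (x + y) = p a x + p a y" for x y
    using assms by (simp add: conformal_product_def clinear_iff)
  show ?thesis
    unfolding nest_right_def star_product_def
    by (rule subst_op_add) (simp_all add: times_mu_add p s)
qed

lemma nest_right_add_left:
  "nest_right (star_product p p') q a b c = nest_right p q a b c + nest_right p' q a b c"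
proof -
  let ?s = "subst_op times_lambda (\<lambda>x::'a. [:[:x:]:])"
  have s: "?s (x + y) = ?s x + ?s y" for x y
    by (rule subst_op_add) (simp_all add: times_lambda_add)
  have "(times_mu ^^ k) (x + y) = (times_mu ^^ k) x + (times_mu ^^ k) y"
    for k and x y :: "'a poly poly"
    by (rule additive_funpow) (rule times_mu_add)
  then show ?thesis
    by (simp add: nest_right_def star_product_def s subst_op_def[of times_mu] sum.distrib)
qed

lemma conformal_product_star:
  assumes "conformal_product p" "conformal_product q"
  shows "conformal_product (star_product p q)"
  using assms
  by (auto simp: conformal_product_def star_product_def clinear_iff scaleC_add_right cderiv_add)

lemma dendriform_assoc:
  assumes "dendriform_conformal_algebra prec succ"
  shows "assoc_conformal_algebra (star_product prec succ)"
proof -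
  have p: "conformal_product prec" and s: "conformal_product succ"
    using assms by (simp_all add: dendriform_conformal_algebra_def)
  let ?m = "star_product prec succ"
  have "nest_left ?m ?m a b c = nest_right ?m ?m a b c" for a b c
  proof -
    have "nest_left ?m ?m a b c =
        nest_left prec prec a b c + nest_left succ prec a b c + nest_left ?m succ a b c"
      by (simp only: nest_left_add_right[of ?m] nest_left_add_left[OF p])
    also have "\<dots> = nest_right prec ?m a b c + (nest_right succ prec a b c + nest_right succ succ a b c)"
      using assms by (simp add: dendriform_conformal_algebra_def add.assoc)
    also have "\<dots> = nest_right ?m ?m a b c"
      by (simp only: nest_right_add_left[of _ _ ?m] nest_right_add_right[OF s])
    finally show ?thesis .
  qed
  then show ?thesis
    by (simp add: assoc_conformal_algebra_def conformal_product_star[OF p s])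
qed

section \<open>The conformal dual\<close>

typedef (overloaded) 'a cdual = "{f :: 'a::cd_module \<Rightarrow> complex poly.
    (\<forall>a b. f (a + b) = f a + f b) \<and> (\<forall>c a. f (c *\<^sub>C a) = smult c (f a)) \<and>
    (\<forall>a. f (\<partial> a) = [:0, 1:] * f a)}"
  morphisms cdual_apply Abs_cdual
  by (rule exI[of _ "\<lambda>_. 0"]) simp

setup_lifting type_definition_cdual

lemma cdual_apply_add: "cdual_apply f (a + b) = cdual_apply f a + cdual_apply f b"
  and cdual_apply_scaleC: "cdual_apply f (c *\<^sub>C a) = smult c (cdual_apply f a)"
  and cdual_apply_cderiv: "cdual_apply f (\<partial> a) = [:0, 1:] * cdual_apply f a"
  using cdual_apply[of f] by auto

instantiation cdual :: (cd_module) cd_module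
begin
lift_definition zero_cdual :: "'a cdual" is "\<lambda>_. 0" by simp
lift_definition plus_cdual :: "'a cdual \<Rightarrow> 'a cdual \<Rightarrow> 'a cdual" is "\<lambda>f g a. f a + g a"
  by (simp add: algebra_simps smult_add_right)
lift_definition uminus_cdual :: "'a cdual \<Rightarrow> 'a cdual" is "\<lambda>f a. - f a"
  by simp
lift_definition minus_cdual :: "'a cdual \<Rightarrow> 'a cdual \<Rightarrow> 'a cdual" is "\<lambda>f g a. f a - g a"
  by (simp add: algebra_simps smult_diff_right)
lift_definition scaleC_cdual :: "complex \<Rightarrow> 'a cdual \<Rightarrow> 'a cdual" is "\<lambda>c f a. smult c (f a)"
  by (simp add: smult_add_right mult.commute)
lift_definition cderiv_cdual :: "'a cdual \<Rightarrow> 'a cdual" is "\<lambda>f a. - ([:0, 1:] * f a)"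
  by (simp add: smult_add_right)
instance
  by standard (transfer; simp add: fun_eq_iff smult_add_right smult_add_left algebra_simps)+
end

text \<open>\<open>neg_subst p\<close> is \<open>p\<close> with its variable replaced by \<open>-\<lambda>-\<partial>\<close>.\<close>

definition neg_subst :: "'m::cd_module poly \<Rightarrow> 'm poly" where
  "neg_subst p = subst_op (\<lambda>q. - pCons 0 q - \<partial> q) (\<lambda>x. [:x:]) p"

definition left_op :: "('a \<Rightarrow> 'a \<Rightarrow> 'a poly) \<Rightarrow> 'a \<Rightarrow> 'a \<Rightarrow> 'a::cd_module poly" where
  "left_op succ a b = succ a b"

definition right_op :: "('a \<Rightarrow> 'a \<Rightarrow> 'a poly) \<Rightarrow> 'a \<Rightarrow> 'a \<Rightarrow> 'a::cd_module poly" where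
  "right_op prec a b = neg_subst (prec b a)"

text \<open>For \<open>T = (b \<mapsto> T\<^sub>\<lambda> b)\<close>, \<open>dual_pairing T f b\<close> is \<open>f\<^bsub>\<mu>-\<lambda>\<^esub>(T\<^sub>\<lambda> b)\<close> in \<open>\<complex>[\<lambda>, \<mu>]\<close>, and
  \<open>dual_op T f\<close> is the polynomial \<open>T\<^sup>*\<^sub>\<lambda> f\<close> in \<open>\<lambda>\<close> over the conformal dual with
  \<open>(T\<^sup>*\<^sub>\<lambda> f)\<^sub>\<mu> b = f\<^bsub>\<mu>-\<lambda>\<^esub>(T\<^sub>\<lambda> b)\<close>. It exists when the module is finitely generated, see
  \<open>coeff_dual_op\<close>.\<close>

definition dual_pairing ::
  "('a::cd_module \<Rightarrow> 'a poly) \<Rightarrow> 'a cdual \<Rightarrow> 'a \<Rightarrow> complex poly poly" where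
  "dual_pairing T f b =
    subst_op times_lambda
      (\<lambda>c. subst_op (\<lambda>P. times_mu P - times_lambda P) (\<lambda>z. [:[:z:]:]) (cdual_apply f c)) (T b)"

definition dual_op :: "('a::cd_module \<Rightarrow> 'a poly) \<Rightarrow> 'a cdual \<Rightarrow> 'a cdual poly" where
  "dual_op T f =
    (THE p. \<forall>b k. cdual_apply (coeff p k) b = coeff (dual_pairing T f b) k)"

text \<open>The product of \<open>A \<ltimes> A\<^sup>*\<^sup>c\<close> for \<open>R\<^sup>*\<^sub>\<prec>\<close> and \<open>L\<^sup>*\<^sub>\<succ>\<close>.\<close>

definition semidirect_product ::
  "('a::cd_module \<Rightarrow> 'a \<Rightarrow> 'a poly) \<Rightarrow> ('a \<Rightarrow> 'a \<Rightarrow> 'a poly) \<Rightarrow>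
    'a \<times> 'a cdual \<Rightarrow> 'a \<times> 'a cdual \<Rightarrow> ('a \<times> 'a cdual) poly" where
  "semidirect_product prec succ = (\<lambda>(a, f) (b, g).
    map_poly (\<lambda>x. (x, 0)) (star_product prec succ a b) +
    map_poly (\<lambda>h. (0, h))
      (dual_op (right_op prec a) g + neg_subst (dual_op (left_op succ b) f)))"

subsection \<open>Existence of the dual action\<close>

lemma times_mu_eq: "times_mu P = [:[:0, 1:]:] * (P :: complex poly poly)"
  by (simp add: times_mu_def poly_eq_iff[of "map_poly _ _"] coeff_map_poly)

lemma times_lambda_eq: "times_lambda P = [:0, 1:] * (P :: complex poly poly)"
  by (simp add: times_lambda_def)

lemma times_mu_lambda:
  "times_mu (times_lambda P) = times_lambda (times_mu P :: complex poly poly)"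
  by (simp only: times_mu_eq times_lambda_eq mult.left_commute)

lemma times_lambda_diff: "times_lambda (P - Q) = times_lambda P - times_lambda Q"
  by (simp add: times_lambda_def)

lemma shift_dual_eq:
  fixes p :: "complex poly"
  defines "s \<equiv> subst_op (\<lambda>P. times_mu P - times_lambda P) (\<lambda>z::complex. [:[:z:]:])"
  shows "s (p + q) = s p + s q" "s (smult c p) = [:[:c:]:] * s p"
    "s ([:0, 1:] * p) = times_mu (s p) - times_lambda (s p)"
proof -
  have T: "times_mu (x + y) - times_lambda (x + y) =
      times_mu x - times_lambda x + (times_mu y - times_lambda y)" for x y :: "complex poly poly"
    by (simp add: times_mu_add times_lambda_add)
  show add: "s (p + q) = s p + s q" for p q
    unfolding s_def by (rule subst_op_add) (simp_all add: T)
  have pC: "s (pCons a p) = [:[:a:]:] + (times_mu (s p) - times_lambda (s p))" for a p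
    unfolding s_def by (rule subst_op_pCons) (simp_all add: T)
  have s0: "s 0 = 0" by (simp add: s_def subst_op_def)
  show "s (smult c p) = [:[:c:]:] * s p"
    by (induction p) (simp_all add: s0 pC times_mu_eq times_lambda_eq algebra_simps)
  show "s ([:0, 1:] * p) = times_mu (s p) - times_lambda (s p)"
    by (simp add: pC)
qed

lemma dual_pairing_linear:
  fixes T :: "'a::cd_module \<Rightarrow> 'a poly"
  assumes T: "clinear T" and T_d: "\<And>b. T (\<partial> b) = \<partial> (T b) + pCons 0 (T b)"
  shows "dual_pairing T f (a + b) = dual_pairing T f a + dual_pairing T f b"
    and "dual_pairing T f (c *\<^sub>C a) = [:[:c:]:] * dual_pairing T f a"
    and "dual_pairing T f (\<partial> a) = [:[:0, 1:]:] * dual_pairing T f a"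
proof -
  define s where "s = subst_op (\<lambda>P. times_mu P - times_lambda P) (\<lambda>z::complex. [:[:z:]:])"
  define j where "j = (\<lambda>c. s (cdual_apply f c))"
  define F where "F = subst_op times_lambda j"
  have j: "j (x + y) = j x + j y" "j (c *\<^sub>C x) = [:[:c:]:] * j x"
    "j (\<partial> x) = times_mu (j x) - times_lambda (j x)" for x y c
    using shift_dual_eq
    by (simp_all only: j_def s_def cdual_apply_add cdual_apply_scaleC cdual_apply_cderiv)
  have dp: "dual_pairing T f b = F (T b)" for b
    by (simp add: dual_pairing_def F_def j_def s_def)
  have F_add: "F (p + q) = F p + F q" for p q
    unfolding F_def by (rule subst_op_add) (simp_all add: times_lambda_add j)
  have F_pCons: "F (pCons x p) = j x + times_lambda (F p)" for x p
    unfolding F_def by (rule subst_op_pCons) (simp_all add: times_lambda_add j)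
  have F0: "F 0 = 0" using additive_0 F_add by blast
  have j0: "j 0 = 0" using additive_0 j(1) by blast
  have sC: "c *\<^sub>C pCons x p = pCons (c *\<^sub>C x) (c *\<^sub>C p)" for c and x :: 'a and p
    by (simp add: poly_eq_iff coeff_pCons split: nat.split)
  have dC: "\<partial> (pCons x p) = pCons (\<partial> x) (\<partial> p)" for x :: 'a and p
    by (simp add: poly_eq_iff coeff_pCons split: nat.split)
  have F_scale: "F (c *\<^sub>C p) = [:[:c:]:] * F p" for c p
    by (induction p) (simp_all add: F0 F_pCons sC j times_lambda_eq algebra_simps)
  have F_d: "F (\<partial> p) = times_mu (F p) - times_lambda (F p)" for p
    by (induction p) (simp_all add: F0 F_pCons dC j times_lambda_add times_mu_add
        times_mu_lambda times_lambda_diff additive_0[of times_mu, OF times_mu_add]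
        additive_0[of times_lambda, OF times_lambda_add])
  show "dual_pairing T f (a + b) = dual_pairing T f a + dual_pairing T f b"
    using T by (simp add: dp F_add clinear_iff)
  show "dual_pairing T f (c *\<^sub>C a) = [:[:c:]:] * dual_pairing T f a"
    using T by (simp add: dp F_scale clinear_iff)
  show "dual_pairing T f (\<partial> a) = [:[:0, 1:]:] * dual_pairing T f a"
    by (simp add: dp T_d F_add F_d F_pCons j0 times_mu_eq)
qed

lemma coeff_dual_op:
  fixes T :: "'a::cd_module \<Rightarrow> 'a poly"
  assumes T: "clinear T" and T_d: "\<And>b. T (\<partial> b) = \<partial> (T b) + pCons 0 (T b)"
    and S: "finite S" "cd_module.span S = (UNIV :: 'a set)"
  shows "cdual_apply (coeff (dual_op T f) k) b = coeff (dual_pairing T f b) k"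
proof -
  note lin = dual_pairing_linear[OF T T_d]
  define h where "h k = Abs_cdual (\<lambda>b. coeff (dual_pairing T f b) k)" for k
  have h: "cdual_apply (h k) b = coeff (dual_pairing T f b) k" for k b
    unfolding h_def by (subst Abs_cdual_inverse) (auto simp: lin)
  obtain N where N: "\<And>b. b \<in> S \<Longrightarrow> degree (dual_pairing T f b) \<le> N"
    using S(1) finite_nat_set_iff_bounded_le[of "(\<lambda>b. degree (dual_pairing T f b)) ` S"] by auto
  have "h k = 0" if k: "k > N" for k
  proof -
    let ?g = "cdual_apply (h k)"
    have pa: "?g (pact p x) = p * ?g x" for p x
      by (induction p) (simp_all add: pact_pCons cdual_apply_add cdual_apply_scaleC
          cdual_apply_cderiv additive_0[of ?g, OF cdual_apply_add])
    have "?g b = 0" for b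
    proof -
      have "b \<in> cd_module.span S" using S by simp
      then show ?thesis
      proof (induction rule: cd_module.span_induct_alt)
        case base then show ?case by (rule additive_0) (rule cdual_apply_add)
      next
        case (step c x y)
        then have "?g x = 0" using N[of x] k by (simp add: h coeff_eq_0)
        then show ?case using step by (simp add: cdual_apply_add pa)
      qed
    qed
    then show ?thesis by (simp add: cdual_apply_inject[symmetric] zero_cdual.rep_eq fun_eq_iff)
  qed
  then have "eventually (\<lambda>k. h k = 0) cofinite"
    unfolding MOST_nat by blast
  then have P: "coeff (Abs_poly h) = h" by (simp add: Abs_poly_inverse)
  have "\<forall>b k. cdual_apply (coeff (dual_op T f) k) b = coeff (dual_pairing T f b) k"
    unfolding dual_op_def
  proof (rule theI[where a = "Abs_poly h"])
    show "\<forall>b k. cdual_apply (coeff (Abs_poly h) k) b = coeff (dual_pairing T f b) k"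
      by (simp add: P h)
  next
    fix q assume "\<forall>b k. cdual_apply (coeff q k) b = coeff (dual_pairing T f b) k"
    then show "q = Abs_poly h"
      by (simp add: poly_eq_iff P cdual_apply_inject[symmetric] fun_eq_iff h)
  qed
  then show ?thesis by blast
qed

section \<open>Tensor products over \<open>\<complex>\<close>\<close>

text \<open>The free complex vector space on \<open>X\<close> consists of the finitely supported functions
  \<open>X \<Rightarrow>\<^sub>0 complex\<close>.\<close>

definition free_scale :: "complex \<Rightarrow> ('x \<Rightarrow>\<^sub>0 complex) \<Rightarrow> 'x \<Rightarrow>\<^sub>0 complex" where
  "free_scale c = Poly_Mapping.map ((*) c)"

lemma lookup_free_scale [simp]: "Poly_Mapping.lookup (free_scale c x) k = c * Poly_Mapping.lookup x k"
  by (simp add: free_scale_def Poly_Mapping.map.rep_eq when_def)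

interpretation free: vector_space "free_scale :: complex \<Rightarrow> ('x \<Rightarrow>\<^sub>0 complex) \<Rightarrow> _"
  by unfold_locales (auto intro!: poly_mapping_eqI simp: lookup_add algebra_simps)

abbreviation gen :: "'a \<Rightarrow> 'b \<Rightarrow> ('a \<times> 'b) \<Rightarrow>\<^sub>0 complex" where
  "gen a b \<equiv> Poly_Mapping.single (a, b) 1"

definition bilinear_relations :: "(('a::complex_vector \<times> 'b::complex_vector) \<Rightarrow>\<^sub>0 complex) set" where
  "bilinear_relations =
    {gen (a + a') b - gen a b - gen a' b | a a' b. True} \<union>
    {gen a (b + b') - gen a b - gen a b' | a b b'. True} \<union>
    {gen (c *\<^sub>C a) b - free_scale c (gen a b) | c a b. True} \<union>
    {gen a (c *\<^sub>C b) - free_scale c (gen a b) | c a b. True}"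

definition tensor_rel :: "(('a::complex_vector \<times> 'b::complex_vector) \<Rightarrow>\<^sub>0 complex) \<Rightarrow> _ \<Rightarrow> bool" where
  "tensor_rel x y \<longleftrightarrow> x - y \<in> free.span bilinear_relations"

lemma diff_diff_swap: "(a - b) - (c - d) = (a - c) - (b - d :: 'a::ab_group_add)"
  by (simp add: algebra_simps)

quotient_type (overloaded) ('a, 'b) tensor =
  "('a::complex_vector \<times> 'b::complex_vector) \<Rightarrow>\<^sub>0 complex" / tensor_rel
proof (rule equivpI)
  show "reflp tensor_rel" by (simp add: reflp_def tensor_rel_def free.span_zero)
  show "symp tensor_rel"
    unfolding symp_def tensor_rel_def using free.span_neg by fastforce
  show "transp tensor_rel"
    unfolding transp_def tensor_rel_def using free.span_add by fastforce
qed

instantiation tensor :: (complex_vector, complex_vector) complex_vector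
begin
lift_definition zero_tensor :: "('a, 'b) tensor" is 0 .
lift_definition plus_tensor :: "('a, 'b) tensor \<Rightarrow> ('a, 'b) tensor \<Rightarrow> ('a, 'b) tensor" is "(+)"
  unfolding tensor_rel_def add_diff_add by (rule free.span_add)
lift_definition uminus_tensor :: "('a, 'b) tensor \<Rightarrow> ('a, 'b) tensor" is uminus
  unfolding tensor_rel_def minus_diff_minus by (rule free.span_neg)
lift_definition minus_tensor :: "('a, 'b) tensor \<Rightarrow> ('a, 'b) tensor \<Rightarrow> ('a, 'b) tensor" is "(-)"
  unfolding tensor_rel_def diff_diff_swap by (rule free.span_diff)
lift_definition scaleC_tensor :: "complex \<Rightarrow> ('a, 'b) tensor \<Rightarrow> ('a, 'b) tensor" is free_scale
  unfolding tensor_rel_def free.scale_right_diff_distrib[symmetric] by (rule free.span_scale)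
instance
  by standard (transfer; simp add: tensor_rel_def free.span_zero algebra_simps
      free.scale_right_distrib free.scale_left_distrib)+
end

lift_definition tensor :: "'a::complex_vector \<Rightarrow> 'b::complex_vector \<Rightarrow> ('a, 'b) tensor"
  (infixr "\<otimes>" 72) is gen .

text \<open>The linear map on the tensor product induced by a bilinear map \<open>f\<close>, computed on a chosen
  representative; see \<open>tensor_lift_tensor\<close>.\<close>

definition tensor_lift ::
  "('a \<Rightarrow> 'b \<Rightarrow> 'c) \<Rightarrow> ('a::complex_vector, 'b::complex_vector) tensor \<Rightarrow> 'c::complex_vector" where
  "tensor_lift f t =
    (\<Sum>k\<in>Poly_Mapping.keys (rep_tensor t).
      Poly_Mapping.lookup (rep_tensor t) k *\<^sub>C f (fst k) (snd k))"

definition cbilinear ::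
  "('a::complex_vector \<Rightarrow> 'b::complex_vector \<Rightarrow> 'c::complex_vector) \<Rightarrow> bool" where
  "cbilinear f \<longleftrightarrow> (\<forall>a. clinear (f a)) \<and> (\<forall>b. clinear (\<lambda>a. f a b))"

lemma bilinear_relationsI:
  "gen (a + a') b - (gen a b + gen a' b) \<in> bilinear_relations"
  "gen a (b + b') - (gen a b + gen a b') \<in> bilinear_relations"
  "gen (c *\<^sub>C a) b - free_scale c (gen a b) \<in> bilinear_relations"
  "gen a (c *\<^sub>C b) - free_scale c (gen a b) \<in> bilinear_relations"
  unfolding bilinear_relations_def Un_iff mem_Collect_eq diff_diff_eq by fast+

lemma tensor_add_left: "(a + a') \<otimes> b = a \<otimes> b + a' \<otimes> b"
  by (transfer, unfold tensor_rel_def) (intro free.span_base bilinear_relationsI)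

lemma tensor_add_right: "a \<otimes> (b + b') = a \<otimes> b + a \<otimes> b'"
  by (transfer, unfold tensor_rel_def) (intro free.span_base bilinear_relationsI)

lemma tensor_scale_left: "(c *\<^sub>C a) \<otimes> b = c *\<^sub>C (a \<otimes> b)"
  by (transfer, unfold tensor_rel_def) (intro free.span_base bilinear_relationsI)

lemma tensor_scale_right: "a \<otimes> (c *\<^sub>C b) = c *\<^sub>C (a \<otimes> b)"
  by (transfer, unfold tensor_rel_def) (intro free.span_base bilinear_relationsI)

lemma cbilinear_tensor: "cbilinear (\<otimes>)"
  by (simp add: cbilinear_def clinear_iff tensor_add_left tensor_add_right
      tensor_scale_left tensor_scale_right)

definition free_ext :: "('a \<Rightarrow> 'b \<Rightarrow> 'c) \<Rightarrow> (('a \<times> 'b) \<Rightarrow>\<^sub>0 complex) \<Rightarrow> 'c::complex_vector" where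
  "free_ext f x = (\<Sum>k\<in>Poly_Mapping.keys x. Poly_Mapping.lookup x k *\<^sub>C f (fst k) (snd k))"

lemma free_ext_superset:
  assumes "finite K" "Poly_Mapping.keys x \<subseteq> K"
  shows "free_ext f x = (\<Sum>k\<in>K. Poly_Mapping.lookup x k *\<^sub>C f (fst k) (snd k))"
  unfolding free_ext_def using assms
  by (intro sum.mono_neutral_left) (auto simp: in_keys_iff)

lemma free_ext_add: "free_ext f (x + y) = free_ext f x + free_ext f y"
proof -
  let ?K = "Poly_Mapping.keys x \<union> Poly_Mapping.keys y"
  have "Poly_Mapping.keys (x + y) \<subseteq> ?K" by (rule keys_add)
  then show ?thesis
    by (simp add: free_ext_superset[of ?K] lookup_add scaleC_add_left sum.distrib)
qed

lemma free_ext_scale: "free_ext f (free_scale c x) = c *\<^sub>C free_ext f x"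
proof -
  have "Poly_Mapping.keys (free_scale c x) \<subseteq> Poly_Mapping.keys x" by (auto simp: in_keys_iff)
  then show ?thesis
    by (simp add: free_ext_superset[of "Poly_Mapping.keys x"] scaleC_scaleC complex_vector.scale_sum_right)
qed

lemma free_ext_0: "free_ext f 0 = 0"
  by (simp add: free_ext_def)

lemma free_ext_minus: "free_ext f (x - y) = free_ext f x - free_ext f y"
  using free_ext_add[of f "x - y" y] by (simp add: algebra_simps)

lemma free_ext_gen: "free_ext f (gen a b) = f a b"
  by (simp add: free_ext_def scaleC_one)

lemma free_ext_relations:
  assumes f: "cbilinear f" and x: "x \<in> free.span bilinear_relations"
  shows "free_ext f x = 0"
  using x
proof (induction rule: free.span_induct_alt)
  case base
  then show ?case by (rule free_ext_0)
next
  case (step c x y)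
  then have "free_ext f x = 0"
    using f unfolding bilinear_relations_def cbilinear_def clinear_iff
    by (auto simp: free_ext_minus free_ext_gen free_ext_scale)
  then show ?case using step by (simp add: free_ext_add free_ext_scale)
qed

lemma tensor_lift_abs:
  assumes "cbilinear f"
  shows "tensor_lift f (abs_tensor x) = free_ext f x"
proof -
  have "tensor_rel (rep_tensor (abs_tensor x)) x"
    using Quotient3_tensor Quotient3_rep_abs[OF Quotient3_tensor, of x]
    by (simp add: tensor_rel_def free.span_zero)
  then have "free_ext f (rep_tensor (abs_tensor x) - x) = 0"
    unfolding tensor_rel_def by (rule free_ext_relations[OF assms])
  then have "free_ext f (rep_tensor (abs_tensor x)) = free_ext f x"
    by (simp add: free_ext_minus)
  then show ?thesis by (simp add: tensor_lift_def free_ext_def)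
qed

lemma tensor_lift_tensor: "cbilinear f \<Longrightarrow> tensor_lift f (a \<otimes> b) = f a b"
  by (simp add: tensor.abs_eq tensor_lift_abs free_ext_gen)

lemma clinear_tensor_lift:
  assumes "cbilinear f"
  shows "clinear (tensor_lift f)"
proof -
  have "tensor_lift f (x + y) = tensor_lift f x + tensor_lift f y" for x y
  proof (induction x; induction y)
    fix x y
    show "tensor_lift f (abs_tensor y + abs_tensor x)
      = tensor_lift f (abs_tensor y) + tensor_lift f (abs_tensor x)"
      by (simp add: plus_tensor.abs_eq tensor_lift_abs[OF assms] free_ext_add)
  qed
  moreover have "tensor_lift f (c *\<^sub>C x) = c *\<^sub>C tensor_lift f x" for c x
    by (induction x) (simp add: scaleC_tensor.abs_eq tensor_lift_abs[OF assms] free_ext_scale)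
  ultimately show ?thesis by (simp add: clinear_iff)
qed

definition tensor_map ::
  "('a \<Rightarrow> 'c) \<Rightarrow> ('b \<Rightarrow> 'd) \<Rightarrow> ('a::complex_vector, 'b::complex_vector) tensor \<Rightarrow>
    ('c::complex_vector, 'd::complex_vector) tensor" where
  "tensor_map f g = tensor_lift (\<lambda>a b. f a \<otimes> g b)"

lemma cbilinear_tensor_map:
  assumes "clinear f" "clinear g"
  shows "cbilinear (\<lambda>a b. f a \<otimes> g b)"
  using assms by (simp add: cbilinear_def clinear_iff tensor_add_left tensor_add_right
      tensor_scale_left tensor_scale_right)

lemma tensor_map_tensor:
  "clinear f \<Longrightarrow> clinear g \<Longrightarrow> tensor_map f g (a \<otimes> b) = f a \<otimes> g b"
  unfolding tensor_map_def by (rule tensor_lift_tensor) (rule cbilinear_tensor_map)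

lemma clinear_tensor_map: "clinear f \<Longrightarrow> clinear g \<Longrightarrow> clinear (tensor_map f g)"
  unfolding tensor_map_def by (rule clinear_tensor_lift) (rule cbilinear_tensor_map)

section \<open>The associative conformal Yang-Baxter equation\<close>

type_synonym 'b tensor3 = "('b, ('b, 'b) tensor) tensor"

definition d1 :: "'b::cd_module tensor3 \<Rightarrow> 'b tensor3" where
  "d1 = tensor_map \<partial> (tensor_map id id)"

definition d2 :: "'b::cd_module tensor3 \<Rightarrow> 'b tensor3" where
  "d2 = tensor_map id (tensor_map \<partial> id)"

definition d3 :: "'b::cd_module tensor3 \<Rightarrow> 'b tensor3" where
  "d3 = tensor_map id (tensor_map id \<partial>)"

definition d_total :: "'b::cd_module tensor3 \<Rightarrow> 'b tensor3" where
  "d_total t = d1 t + d2 t + d3 t"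

text \<open>The summand of \<open>r \<bullet> r\<close> for \<open>r\<^sub>i \<otimes> l\<^sub>i = u \<otimes> x\<close> and \<open>r\<^sub>j \<otimes> l\<^sub>j = v \<otimes> y\<close>.\<close>

definition bullet_term ::
  "('b \<Rightarrow> 'b \<Rightarrow> 'b poly) \<Rightarrow> 'b \<Rightarrow> 'b \<Rightarrow> 'b \<Rightarrow> 'b \<Rightarrow> 'b::cd_module tensor3" where
  "bullet_term m u x v y =
    subst_op d1 (\<lambda>c. u \<otimes> v \<otimes> c) (m x y)
    - subst_op (\<lambda>t. - (d1 t + d2 t)) (\<lambda>c. u \<otimes> c \<otimes> y) (m v x)
    + subst_op d2 (\<lambda>c. c \<otimes> x \<otimes> y) (m u v)"

text \<open>The element \<open>r \<bullet> r\<close>; \<open>bullet_sum\<close> gives it for an arbitrary expression of \<open>r\<close> as a sum of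
  pure tensors.\<close>

definition bullet ::
  "('b \<Rightarrow> 'b \<Rightarrow> 'b poly) \<Rightarrow> ('b, 'b) tensor \<Rightarrow> 'b::cd_module tensor3" where
  "bullet m r = tensor_lift (\<lambda>u x. tensor_lift (\<lambda>v y. bullet_term m u x v y) r) r"

definition acybe_solution ::
  "('b \<Rightarrow> 'b \<Rightarrow> 'b poly) \<Rightarrow> ('b::cd_module, 'b) tensor \<Rightarrow> bool" where
  "acybe_solution m r \<longleftrightarrow> bullet m r \<in> range d_total"

lemma clinear_d:
  "clinear (d1 :: 'b::cd_module tensor3 \<Rightarrow> _)" "clinear (d2 :: 'b tensor3 \<Rightarrow> _)"
  "clinear (d3 :: 'b tensor3 \<Rightarrow> _)"
  by (simp_all add: d1_def d2_def d3_def clinear_tensor_map clinear_cderiv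
      complex_vector.linear_id)

lemma clinear_d12: "clinear (\<lambda>t :: 'a::cd_module tensor3. - (d1 t + d2 t))"
  using clinear_d(1,2)[where 'b = 'a]
  by (simp add: clinear_iff complex_vector.scale_right_diff_distrib)

lemma clinear_funpow:
  fixes T :: "'m::complex_vector \<Rightarrow> 'm"
  shows "clinear T \<Longrightarrow> clinear (T ^^ k)"
  by (induction k) (simp_all add: clinear_iff)

lemma subst_op_scaleC:
  assumes T: "clinear T" and j: "clinear j"
  shows "subst_op T j (c *\<^sub>C p) = c *\<^sub>C subst_op T j p"
proof -
  have T0: "T 0 = 0" and j0: "j 0 = 0" using additive_0 T j unfolding clinear_iff by blast+
  have "degree (c *\<^sub>C p) \<le> degree p"
    by (rule degree_le) (simp add: coeff_eq_0)
  then have "subst_op T j (c *\<^sub>C p) = (\<Sum>k\<le>degree p. (T ^^ k) (j (c *\<^sub>C coeff p k)))"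
    using subst_op_bound[where T = T and j = j and p = "c *\<^sub>C p", OF T0 j0] by simp
  also have "\<dots> = c *\<^sub>C subst_op T j p"
    using j clinear_funpow[OF T]
    by (simp add: subst_op_def complex_vector.scale_sum_right clinear_iff)
  finally show ?thesis .
qed

lemma clinear_subst_op:
  assumes "clinear T" "clinear j" "clinear p"
  shows "clinear (\<lambda>x. subst_op T j (p x))"
  using assms subst_op_scaleC[of T j] subst_op_add[of T j] by (simp add: clinear_iff)

lemma clinear_subst_op_fun:
  assumes "clinear T" "\<And>c. clinear (\<lambda>x. j x c)"
  shows "clinear (\<lambda>x. subst_op T (j x) p)"
  using assms(2) clinear_funpow[OF assms(1)]
  by (simp add: clinear_iff subst_op_def sum.distrib complex_vector.scale_sum_right)

lemma clinear_tensors: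
  "clinear (\<lambda>x. x \<otimes> b)" "clinear (\<lambda>x. a \<otimes> x)"
  "clinear (\<lambda>x. a \<otimes> x \<otimes> b)" "clinear (\<lambda>x. a \<otimes> b \<otimes> x)"
  by (simp_all add: clinear_iff tensor_add_left tensor_add_right
      tensor_scale_left tensor_scale_right)

lemma clinear_combine:
  "clinear f \<Longrightarrow> clinear g \<Longrightarrow> clinear h \<Longrightarrow> clinear (\<lambda>x. f x - g x + h x)"
  by (simp add: clinear_iff complex_vector.scale_right_distrib complex_vector.scale_right_diff_distrib)

lemma clinear_bullet_term:
  fixes m :: "'b::cd_module \<Rightarrow> 'b \<Rightarrow> 'b poly"
  assumes m: "conformal_product m"
  shows "clinear (\<lambda>u. bullet_term m u x v y)" "clinear (\<lambda>x. bullet_term m u x v y)"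
    "clinear (\<lambda>v. bullet_term m u x v y)" "clinear (\<lambda>y. bullet_term m u x v y)"
proof -
  have ml: "clinear (\<lambda>a. m a b)" and mr: "clinear (\<lambda>b. m a b)" for a b
    using m by (simp_all add: conformal_product_def)
  show "clinear (\<lambda>u. bullet_term m u x v y)" "clinear (\<lambda>x. bullet_term m u x v y)"
    "clinear (\<lambda>v. bullet_term m u x v y)" "clinear (\<lambda>y. bullet_term m u x v y)"
    unfolding bullet_term_def
    by (intro clinear_combine clinear_subst_op_fun clinear_subst_op clinear_d clinear_d12
        clinear_tensors ml mr)+
qed

lemma tensor_lift_sum:
  assumes "cbilinear f"
  shows "tensor_lift f (\<Sum>i\<in>I. x i \<otimes> y i) = (\<Sum>i\<in>I. f (x i) (y i))"
proof -
  have "tensor_lift f 0 = 0"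
    using additive_0 clinear_tensor_lift[OF assms] unfolding clinear_iff by blast
  then show ?thesis
    using clinear_tensor_lift[OF assms]
    by (induction I rule: infinite_finite_induct) (simp_all add: clinear_iff tensor_lift_tensor[OF assms])
qed

lemma clinear_sum:
  assumes "\<And>i. i \<in> I \<Longrightarrow> clinear (f i)"
  shows "clinear (\<lambda>x. \<Sum>i\<in>I. f i x)"
  using assms by (simp add: clinear_iff sum.distrib complex_vector.scale_sum_right)

lemma bullet_sum:
  assumes m: "conformal_product m"
  shows "bullet m (\<Sum>i\<in>I. r i \<otimes> l i) = (\<Sum>i\<in>I. \<Sum>j\<in>I. bullet_term m (r i) (l i) (r j) (l j))"
proof -
  note lin = clinear_bullet_term[OF m]
  have 1: "cbilinear (\<lambda>v y. bullet_term m u x v y)" for u x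
    by (simp add: cbilinear_def lin)
  have "clinear (\<lambda>x. \<Sum>j\<in>I. bullet_term m u x (r j) (l j))"
    and "clinear (\<lambda>u. \<Sum>j\<in>I. bullet_term m u x (r j) (l j))" for u x
    by (intro clinear_sum lin)+
  then have 2: "cbilinear (\<lambda>u x. \<Sum>j\<in>I. bullet_term m u x (r j) (l j))"
    by (simp add: cbilinear_def)
  show ?thesis
    unfolding bullet_def tensor_lift_sum[OF 1] tensor_lift_sum[OF 2] ..
qed

end

theory Submission
  imports Defs
begin

text \<open>
  Write \<open>e\<^sub>i \<succ>\<^sub>\<lambda> e\<^sub>j = \<Sum>\<^sub>k P\<^sub>i\<^sub>j\<^sup>k(\<lambda>, \<partial>) e\<^sub>k\<close> and \<open>e\<^sub>i \<prec>\<^sub>\<lambda> e\<^sub>j = \<Sum>\<^sub>k Q\<^sub>i\<^sub>j\<^sup>k(\<lambda>, \<partial>) e\<^sub>k\<close>. In the semidirect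
  product, \<open>e\<^sub>i\<close> times \<open>e\<^sub>j\<^sup>*\<close> is \<open>\<Sum>\<^sub>k Q\<^sub>k\<^sub>i\<^sup>j(\<partial>, -\<lambda>-\<partial>) e\<^sub>k\<^sup>*\<close> and \<open>e\<^sub>j\<^sup>*\<close> times \<open>e\<^sub>i\<close> is
  \<open>\<Sum>\<^sub>k P\<^sub>i\<^sub>k\<^sup>j(-\<lambda>-\<partial>, \<lambda>) e\<^sub>k\<^sup>*\<close>. Let \<open>\<partial>\<^sub>1, \<partial>\<^sub>2, \<partial>\<^sub>3\<close> act on the three tensor factors. Modulo
  \<open>\<partial>\<^sub>1 + \<partial>\<^sub>2 + \<partial>\<^sub>3\<close>, every contribution to \<open>r \<bullet> r\<close> takes the form \<open>P\<^sub>i\<^sub>j\<^sup>k(\<partial>\<^sub>a, \<partial>\<^sub>c)\<close> or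
  \<open>Q\<^sub>i\<^sub>j\<^sup>k(\<partial>\<^sub>a, \<partial>\<^sub>c)\<close> applied to the tensor with \<open>e\<^sub>i\<^sup>*, e\<^sub>j\<^sup>*, e\<^sub>k\<close> at the positions \<open>a, b, c\<close>. The
  product \<open>e\<^sub>i * e\<^sub>j\<close> contributes \<open>P + Q\<close>, and the two mixed products cancel \<open>P\<close> and \<open>Q\<close>
  separately.
\<close>

section \<open>Additive and linear maps\<close>

lemma additive_sum:
  fixes h :: "'m::ab_group_add \<Rightarrow> 'n::ab_group_add"
  assumes "\<And>x y. h (x + y) = h x + h y"
  shows "h (\<Sum>i\<in>I. f i) = (\<Sum>i\<in>I. h (f i))"
  by (induction I rule: infinite_finite_induct) (simp_all add: assms additive_0[of h])

lemma additive_uminus: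
  fixes h :: "'m::ab_group_add \<Rightarrow> 'n::ab_group_add"
  assumes "\<And>x y. h (x + y) = h x + h y"
  shows "h (- x) = - h x"
  using assms[of x "- x"] additive_0[of h] assms by (simp add: eq_neg_iff_add_eq_0 add.commute)

lemma additive_diff:
  fixes h :: "'m::ab_group_add \<Rightarrow> 'n::ab_group_add"
  assumes "\<And>x y. h (x + y) = h x + h y"
  shows "h (x - y) = h x - h y"
  using assms[of x "- y"] additive_uminus[of h y] assms by simp

lemma clinear_add: "clinear f \<Longrightarrow> f (x + y) = f x + f y"
  and clinear_scaleC: "clinear f \<Longrightarrow> f (c *\<^sub>C x) = c *\<^sub>C f x"
  by (simp_all add: clinear_iff)

lemma clinear_0: "clinear f \<Longrightarrow> f 0 = 0"
  by (rule additive_0) (rule clinear_add)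

section \<open>Polynomials with operators substituted for the variables\<close>

text \<open>\<open>h\<close> passes through every power of \<open>T\<close> separately. Later
  changes of operators, under evaluation, inclusion or tensoring, rest on this.\<close>

lemma subst_op_hom:
  fixes h :: "'m::ab_group_add \<Rightarrow> 'n::ab_group_add"
  assumes h: "\<And>x y. h (x + y) = h x + h y" and "\<And>x. h (T x) = T' (h x)"
  shows "h (subst_op T j p) = subst_op T' (\<lambda>c. h (j c)) p"
proof -
  have "h ((T ^^ k) x) = (T' ^^ k) (h x)" for k x
    by (induction k) (simp_all add: assms)
  then show ?thesis by (simp add: subst_op_def additive_sum[of h, OF h])
qed

lemma subst_op_map_poly:
  assumes "T 0 = 0" "j 0 = 0" "g 0 = 0"
  shows "subst_op T j (map_poly g p) = subst_op T (\<lambda>c. j (g c)) p"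
proof -
  have "subst_op T j (map_poly g p) = (\<Sum>k\<le>degree p. (T ^^ k) (j (coeff (map_poly g p) k)))"
    by (rule subst_op_bound) (use assms in \<open>simp_all add: degree_le coeff_map_poly coeff_eq_0\<close>)
  then show ?thesis by (simp add: subst_op_def coeff_map_poly assms)
qed

text \<open>\<open>subst2 A B j F\<close> is \<open>F(A, B) x\<close> when \<open>j c = c x\<close>; \<open>A\<close> replaces the outer variable of \<open>F\<close>.\<close>

definition subst2 ::
  "('m \<Rightarrow> 'm) \<Rightarrow> ('m \<Rightarrow> 'm) \<Rightarrow> ('c \<Rightarrow> 'm) \<Rightarrow> 'c::zero poly poly \<Rightarrow> 'm::comm_monoid_add" where
  "subst2 A B j F = subst_op A (subst_op B j) F"

lemma subst2_hom:
  fixes h :: "'m::ab_group_add \<Rightarrow> 'n::ab_group_add"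
  assumes "\<And>x y. h (x + y) = h x + h y" "\<And>x. h (A x) = A' (h x)" "\<And>x. h (B x) = B' (h x)"
  shows "h (subst2 A B j F) = subst2 A' B' (\<lambda>c. h (j c)) F"
  unfolding subst2_def
  by (simp add: subst_op_hom[of h A A'] subst_op_hom[of h B B'] assms)

lemma subst_op_eq_0: "T 0 = 0 \<Longrightarrow> subst_op T (\<lambda>_. 0) p = 0"
  by (simp add: subst_op_def zero_funpow)

lemma subst2_eq_0:
  assumes "A 0 = 0" "B 0 = 0"
  shows "subst2 A B (\<lambda>_. 0) F = 0"
proof -
  have "subst_op B (\<lambda>_. 0) p = 0" for p :: "'b poly"
    by (rule subst_op_eq_0) (rule assms)
  then show ?thesis by (simp add: subst2_def subst_op_def[of A] assms zero_funpow)
qed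

text \<open>Along Horner's scheme the splitting
  \<open>T x - T' y = (T x - T' x) + T' (x - y)\<close> propagates the congruence, so stability of
  \<open>W\<close> is asked of \<open>T'\<close> alone.\<close>

lemma subst_op_cong_mod:
  fixes T T' :: "'m::ab_group_add \<Rightarrow> 'm" and j j' :: "'c::ab_group_add \<Rightarrow> 'm"
  assumes T: "\<And>x y. T (x + y) = T x + T y" and j: "\<And>x y. j (x + y) = j x + j y"
    and T': "\<And>x y. T' (x + y) = T' x + T' y" and j': "\<And>x y. j' (x + y) = j' x + j' y"
    and W: "0 \<in> W" "\<And>x y. x \<in> W \<Longrightarrow> y \<in> W \<Longrightarrow> x + y \<in> W"
    and W_T: "\<And>x. T x - T' x \<in> W" "\<And>x. x \<in> W \<Longrightarrow> T' x \<in> W"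
    and W_j: "\<And>x. j x - j' x \<in> W"
  shows "subst_op T j p - subst_op T' j' p \<in> W"
proof (induction p)
  case 0
  then show ?case using W_j[of 0] additive_0[of j] additive_0[of j'] j j' by simp
next
  case (pCons a p)
  let ?x = "subst_op T j p" and ?y = "subst_op T' j' p"
  have "subst_op T j (pCons a p) - subst_op T' j' (pCons a p) =
      (j a - j' a) + ((T ?x - T' ?x) + T' (?x - ?y))"
    by (simp add: subst_op_pCons T j T' j' additive_diff[of T', OF T'])
  then show ?case using pCons W W_T W_j by metis
qed

section \<open>Operators on the threefold tensor product\<close>

text \<open>Every tensor is the class of a finitely supported function, hence a finite linear
  combination of pure tensors.\<close>

lemma clinear_ext_tensor:
  assumes f: "clinear f" and g: "clinear g" and eq: "\<And>a b. f (a \<otimes> b) = g (a \<otimes> b)"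
  shows "f t = g t"
proof (induction t)
  fix x :: "('a \<times> 'b) \<Rightarrow>\<^sub>0 complex"
  let ?K = "Poly_Mapping.keys x" and ?c = "Poly_Mapping.lookup x"
  have x: "x = (\<Sum>k\<in>?K. free_scale (?c k) (gen (fst k) (snd k)))"
    by (rule poly_mapping_eqI)
      (auto simp: lookup_sum lookup_single when_def in_keys_iff if_distrib cong: if_cong)
  have add: "abs_tensor (p + q) = abs_tensor p + abs_tensor q"
    for p q :: "('a \<times> 'b) \<Rightarrow>\<^sub>0 complex"
    by (simp add: plus_tensor.abs_eq)
  have "abs_tensor x = (\<Sum>k\<in>?K. abs_tensor (free_scale (?c k) (gen (fst k) (snd k))))"
    by (subst x) (rule additive_sum[of abs_tensor, OF add])
  also have "\<dots> = (\<Sum>k\<in>?K. ?c k *\<^sub>C (fst k \<otimes> snd k))"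
    by (simp only: tensor.abs_eq scaleC_tensor.abs_eq)
  finally show "f (abs_tensor x) = g (abs_tensor x)"
    by (simp add: additive_sum[of f, OF clinear_add[OF f]] additive_sum[of g, OF clinear_add[OF g]]
        clinear_scaleC[OF f] clinear_scaleC[OF g] eq)
qed

lemma clinear_ext_tensor3:
  fixes f g :: "('a::complex_vector, ('b::complex_vector, 'c::complex_vector) tensor) tensor \<Rightarrow> 'd::complex_vector"
  assumes f: "clinear f" and g: "clinear g" and eq: "\<And>a b c. f (a \<otimes> b \<otimes> c) = g (a \<otimes> b \<otimes> c)"
  shows "f t = g t"
proof (rule clinear_ext_tensor[OF f g])
  fix a t
  have "clinear (\<lambda>t. f (a \<otimes> t))" "clinear (\<lambda>t. g (a \<otimes> t))"
    using f g by (simp_all add: clinear_iff tensor_add_right tensor_scale_right)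
  then show "f (a \<otimes> t) = g (a \<otimes> t)" by (rule clinear_ext_tensor) (rule eq)
qed

lemma d_tensor:
  "d1 (a \<otimes> b \<otimes> c) = \<partial> a \<otimes> b \<otimes> c" "d2 (a \<otimes> b \<otimes> c) = a \<otimes> \<partial> b \<otimes> c"
  "d3 (a \<otimes> b \<otimes> c) = a \<otimes> b \<otimes> \<partial> c"
  by (simp_all add: d1_def d2_def d3_def tensor_map_tensor clinear_tensor_map clinear_cderiv
      complex_vector.linear_id)

lemma clinear_comp: "clinear f \<Longrightarrow> clinear g \<Longrightarrow> clinear (\<lambda>x. f (g x))"
  by (simp add: clinear_iff)

lemma d_commute:
  "d1 (d2 t) = d2 (d1 t)" "d1 (d3 t) = d3 (d1 t)" "d2 (d3 t) = d3 (d2 t)"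
  by (rule clinear_ext_tensor3; simp add: clinear_comp clinear_d d_tensor)+

lemmas d_add = clinear_d[THEN clinear_add]

lemma d_total_add: "d_total (x + y) = d_total x + d_total y"
  by (simp add: d_total_def d_add)

section \<open>The substitution of \<open>-\<lambda>-\<partial>\<close>\<close>

lemma scaleC_pCons: "c *\<^sub>C pCons x p = pCons (c *\<^sub>C x) (c *\<^sub>C p)"
  and cderiv_pCons: "\<partial> (pCons y q) = pCons (\<partial> y) (\<partial> q)"
  by (simp_all add: poly_eq_iff coeff_pCons split: nat.split)

lemma cderiv_minus: "\<partial> (- x) = - \<partial> (x :: 'a::cd_module)"
  and cderiv_diff: "\<partial> (x - y) = \<partial> x - \<partial> y"
  by (rule additive_uminus additive_diff; rule cderiv_add)+

text \<open>Multiplication by \<open>-\<lambda>-\<partial>\<close> on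
  \<open>M[\<lambda>]\<close>.\<close>

definition neg_op :: "'m::cd_module poly \<Rightarrow> 'm poly" where
  "neg_op q = - pCons 0 q - \<partial> q"

lemma neg_op_add: "neg_op (p + q) = neg_op p + neg_op q"
  by (simp add: neg_op_def cderiv_add)

lemma pCons_0_add: "pCons 0 (p + q) = pCons 0 p + pCons 0 (q :: 'm::ab_group_add poly)"
  and pCons_0_minus: "pCons 0 (- p) = - pCons 0 p"
  and pCons_0_diff: "pCons 0 (p - q) = pCons 0 p - pCons 0 q"
  by simp_all

text \<open>Since \<open>T\<close> commutes with \<open>d\<close> and \<open>j\<close> carries
  \<open>\<partial>\<close> to \<open>d\<close>, the substitution \<open>h\<close> translates
  \<lambda> into \<open>T\<close>, \<partial> into \<open>d\<close> and
  \<open>-\<lambda>-\<partial>\<close> into \<open>-T-d\<close>. It serves for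
  \<open>neg_subst\<close>, for the pairing with functionals and for the tensor factors.\<close>

lemma subst_op_operators:
  fixes j :: "'m::cd_module \<Rightarrow> 'n::ab_group_add"
  assumes T: "\<And>x y. T (x + y) = T x + T y" and j: "\<And>x y. j (x + y) = j x + j y"
    and d: "\<And>x y. d (x + y) = d x + d y"
    and j_d: "\<And>x. j (\<partial> x) = d (j x)" and T_d: "\<And>x. T (d x) = d (T x)"
  defines "h \<equiv> subst_op T j"
  shows "h (p + q) = h p + h q" "h [:x:] = j x" "h (pCons 0 p) = T (h p)" "h (\<partial> p) = d (h p)"
    "h (neg_op p) = - T (h p) - d (h p)"
proof -
  have h0: "h 0 = 0" by (simp add: h_def additive_0[of j] j)
  show add: "h (p + q) = h p + h q" for p q
    unfolding h_def by (rule subst_op_add[OF T j])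
  have pC: "h (pCons x p) = j x + T (h p)" for x p
    unfolding h_def by (rule subst_op_pCons[OF T j])
  show "h [:x:] = j x" by (simp add: pC h0 additive_0[of T] T)
  show Lam: "h (pCons 0 p) = T (h p)" for p by (simp add: pC additive_0[of j] j)
  show der: "h (\<partial> p) = d (h p)" for p
    by (induction p) (simp_all add: h0 additive_0[of d] d pC cderiv_pCons j_d T_d)
  show "h (neg_op p) = - T (h p) - d (h p)"
    by (simp only: neg_op_def additive_diff[of h, OF add] additive_uminus[of h, OF add] Lam der)
qed

lemma neg_subst_eq: "neg_subst = subst_op neg_op (\<lambda>x. [:x:])"
  by (simp add: neg_subst_def[abs_def] neg_op_def[abs_def])

text \<open>The last equation is \<open>-(-\<lambda>-\<partial>)-\<partial> = \<lambda>\<close>: the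
  substitution exchanges the operators \<lambda> and \<open>-\<lambda>-\<partial>\<close> and
  commutes with \<partial>.\<close>

lemma neg_subst_simps:
  "neg_subst (p + q) = neg_subst p + neg_subst q" "neg_subst [:x:] = [:x:]"
  "neg_subst (pCons 0 p) = neg_op (neg_subst p)"
  "neg_subst (\<partial> p) = \<partial> (neg_subst p)"
  "neg_subst (neg_op p) = pCons 0 (neg_subst p)"
proof -
  note * = subst_op_operators[where T = neg_op and d = \<partial> and j = "\<lambda>x. [:x:]"]
  show "neg_subst (p + q) = neg_subst p + neg_subst q" "neg_subst [:x:] = [:x:]"
    "neg_subst (pCons 0 p) = neg_op (neg_subst p)"
    "neg_subst (\<partial> p) = \<partial> (neg_subst p)"
    unfolding neg_subst_eq
    by (rule *; simp add: neg_op_add cderiv_add cderiv_pCons neg_op_def cderiv_minus cderiv_diff)+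
  have "neg_subst (neg_op p) = - neg_op (neg_subst p) - \<partial> (neg_subst p)"
    unfolding neg_subst_eq
    by (rule *; simp add: neg_op_add cderiv_add cderiv_pCons neg_op_def cderiv_minus cderiv_diff)
  then show "neg_subst (neg_op p) = pCons 0 (neg_subst p)" by (simp add: neg_op_def)
qed

lemma neg_subst_minus: "neg_subst (- p) = - neg_subst p"
  by (rule additive_uminus) (rule neg_subst_simps)

lemma neg_subst_scaleC: "neg_subst (c *\<^sub>C p) = c *\<^sub>C neg_subst p"
  unfolding neg_subst_eq
  by (rule subst_op_scaleC)
    (simp_all add: clinear_iff scaleC_pCons neg_op_def cderiv_scaleC cderiv_add
      complex_vector.scale_right_diff_distrib)

lemma conformal_product_left_op: "conformal_product succ \<Longrightarrow> conformal_product (left_op succ)"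
  by (simp add: conformal_product_def left_op_def)

text \<open>Putting \<open>\<nu> = -\<lambda>-\<partial>\<close> turns the factor
  \<open>-\<nu>\<close> of the first argument of \<open>prec\<close> into
  \<open>\<lambda>+\<partial>\<close>, and the factor \<open>\<partial>+\<nu>\<close> of the second
  into \<open>-\<lambda>\<close>; with the arguments swapped, the same two rules reappear.\<close>

lemma conformal_product_right_op: "conformal_product prec \<Longrightarrow> conformal_product (right_op prec)"
  unfolding conformal_product_def right_op_def clinear_iff
  by (simp add: neg_subst_simps neg_subst_scaleC neg_subst_minus) (simp add: neg_op_def cderiv_minus)

section \<open>The dual action\<close>

definition lam :: "complex poly poly" where "lam = [:0, 1:]"
definition mu :: "complex poly poly" where "mu = [:[:0, 1:]:]"

text \<open>The outer variable \<lambda> is that of \<open>p\<close>, the inner one \<mu> the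
  argument of the functional. On the dual \<partial> acts as \<open>-\<mu>\<close>, so
  \<open>-\<lambda>-\<partial>\<close> becomes \<open>\<mu>-\<lambda>\<close>.\<close>

definition dual_eval :: "'a::cd_module cdual poly \<Rightarrow> 'a \<Rightarrow> complex poly poly" where
  "dual_eval p b = map_poly (\<lambda>f. cdual_apply f b) p"

lemma cdual_apply_simps:
  "cdual_apply 0 b = 0" "cdual_apply (f + g) b = cdual_apply f b + cdual_apply g b"
  "cdual_apply (c *\<^sub>C f) b = smult c (cdual_apply f b)"
  "cdual_apply (- f) b = - cdual_apply f b"
  "cdual_apply (\<partial> f) b = - ([:0, 1:] * cdual_apply f b)"
  by (simp_all add: zero_cdual.rep_eq plus_cdual.rep_eq scaleC_cdual.rep_eq uminus_cdual.rep_eq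
      cderiv_cdual.rep_eq)

lemma coeff_dual_eval: "coeff (dual_eval p b) k = cdual_apply (coeff p k) b"
  by (simp add: dual_eval_def coeff_map_poly cdual_apply_simps)

lemma dual_eval_simps:
  "dual_eval (p + q) b = dual_eval p b + dual_eval q b"
  "dual_eval (- p) b = - dual_eval p b"
  "dual_eval (c *\<^sub>C p) b = [:[:c:]:] * dual_eval p b"
  "dual_eval (\<partial> p) b = - (mu * dual_eval p b)"
  "dual_eval (pCons 0 p) b = lam * dual_eval p b"
  "dual_eval (neg_op p) b = (mu - lam) * dual_eval p b"
  "dual_eval [:f:] b = [:cdual_apply f b:]"
proof -
  show add: "dual_eval (p + q) b = dual_eval p b + dual_eval q b" for p q
    by (simp add: poly_eq_iff[of "dual_eval _ _"] coeff_dual_eval cdual_apply_simps)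
  show neg: "dual_eval (- p) b = - dual_eval p b" for p
    by (simp add: poly_eq_iff[of "dual_eval _ _"] coeff_dual_eval cdual_apply_simps)
  show "dual_eval (c *\<^sub>C p) b = [:[:c:]:] * dual_eval p b"
    by (simp add: poly_eq_iff[of "dual_eval _ _"] coeff_dual_eval cdual_apply_simps)
  show der: "dual_eval (\<partial> p) b = - (mu * dual_eval p b)" for p
    by (simp add: poly_eq_iff[of "dual_eval _ _"] coeff_dual_eval cdual_apply_simps mu_def)
  show lam: "dual_eval (pCons 0 p) b = lam * dual_eval p b" for p
    by (simp add: poly_eq_iff[of "dual_eval _ _"] coeff_dual_eval cdual_apply_simps lam_def
        coeff_pCons split: nat.split)
  show "dual_eval (neg_op p) b = (mu - lam) * dual_eval p b"
    unfolding neg_op_def diff_conv_add_uminus add neg der lam by (simp add: algebra_simps)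
  show "dual_eval [:f:] b = [:cdual_apply f b:]"
    by (simp add: poly_eq_iff[of "dual_eval _ _"] coeff_dual_eval cdual_apply_simps
        coeff_pCons split: nat.split)
qed

lemma dual_eval_arg:
  "dual_eval p (a + b) = dual_eval p a + dual_eval p b"
  "dual_eval p (c *\<^sub>C b) = [:[:c:]:] * dual_eval p b"
  "dual_eval p (\<partial> b) = [:[:0, 1:]:] * dual_eval p b"
  by (simp_all add: poly_eq_iff[of "dual_eval _ _"] coeff_dual_eval cdual_apply_add
      cdual_apply_scaleC cdual_apply_cderiv)

lemma dual_eval_inject: "(\<And>b. dual_eval p b = dual_eval q b) \<Longrightarrow> p = q"
  by (simp add: poly_eq_iff coeff_dual_eval cdual_apply_inject[symmetric] fun_eq_iff)

section \<open>Functionals taken at the argument \<open>\<mu>-\<lambda>\<close>\<close>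

definition shift_subst :: "complex poly \<Rightarrow> complex poly poly" where
  "shift_subst = subst_op ((*) (mu - lam)) (\<lambda>z. [:[:z:]:])"

text \<open>\<open>shift_pairing f q\<close> is \<open>f\<^bsub>\<mu>-\<lambda>\<^esub>(q)\<close>, so that \<open>dual_pairing T f b = shift_pairing f (T b)\<close>.\<close>

definition shift_pairing :: "'a::cd_module cdual \<Rightarrow> 'a poly \<Rightarrow> complex poly poly" where
  "shift_pairing f = subst_op ((*) lam) (\<lambda>c. shift_subst (cdual_apply f c))"

lemma shift_subst_operator:
  "(\<lambda>P. times_mu P - times_lambda P) = (*) (mu - lam)"
  by (simp add: fun_eq_iff times_mu_eq times_lambda_eq mu_def lam_def algebra_simps)

lemma dual_pairing_eq: "dual_pairing T f b = shift_pairing f (T b)"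
proof -
  have "(times_lambda :: complex poly poly \<Rightarrow> _) = (*) lam"
    by (simp add: fun_eq_iff times_lambda_eq lam_def)
  then show ?thesis
    by (simp only: dual_pairing_def shift_pairing_def shift_subst_def shift_subst_operator)
qed

lemma shift_subst_simps:
  "shift_subst (p + q) = shift_subst p + shift_subst q"
  "shift_subst (smult c p) = [:[:c:]:] * shift_subst p"
  "shift_subst ([:0, 1:] * p) = (mu - lam) * shift_subst p"
  using shift_dual_eq(1)[of p q] shift_dual_eq(2)[of c p] shift_dual_eq(3)[of p]
  unfolding shift_subst_def shift_subst_operator fun_cong[OF shift_subst_operator] .

lemma shift_subst_minus: "shift_subst (- p) = - shift_subst p"
  by (rule additive_uminus) (rule shift_subst_simps)

text \<open>The pairing turns \<partial> on \<open>A\<close> into \<open>\<mu>-\<lambda>\<close>,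
  hence \<open>-\<lambda>-\<partial>\<close> into \<open>-\<mu>\<close>, which is free of
  \<lambda>.\<close>

lemma shift_pairing_simps:
  "shift_pairing f (p + q) = shift_pairing f p + shift_pairing f q"
  "shift_pairing f (pCons 0 p) = lam * shift_pairing f p"
  "shift_pairing f (\<partial> p) = (mu - lam) * shift_pairing f p"
  "shift_pairing f (neg_op p) = - (mu * shift_pairing f p)"
  "shift_pairing f [:x:] = shift_subst (cdual_apply f x)"
proof -
  note * = subst_op_operators[where T = "(*) lam" and d = "(*) (mu - lam)"
      and j = "\<lambda>c. shift_subst (cdual_apply f c)", folded shift_pairing_def]
  show "shift_pairing f (p + q) = shift_pairing f p + shift_pairing f q"
    "shift_pairing f (pCons 0 p) = lam * shift_pairing f p"
    "shift_pairing f (\<partial> p) = (mu - lam) * shift_pairing f p"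
    "shift_pairing f [:x:] = shift_subst (cdual_apply f x)"
    by (rule *; simp only: cdual_apply_add cdual_apply_cderiv shift_subst_simps
          distrib_left mult.left_commute)+
  have "shift_pairing f (neg_op p) = - (lam * shift_pairing f p) - (mu - lam) * shift_pairing f p"
    by (rule *; simp only: cdual_apply_add cdual_apply_cderiv shift_subst_simps
          distrib_left mult.left_commute)
  then show "shift_pairing f (neg_op p) = - (mu * shift_pairing f p)" by (simp add: algebra_simps)
qed

lemma shift_pairing_minus: "shift_pairing f (- p) = - shift_pairing f p"
  by (rule additive_uminus) (rule shift_pairing_simps)

lemma shift_pairing_pCons:
  "shift_pairing f (pCons x p) = shift_subst (cdual_apply f x) + lam * shift_pairing f p"
  using shift_pairing_simps(1)[of f "[:x:]" "pCons 0 p"] by (simp add: shift_pairing_simps)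

lemma shift_pairing_0: "shift_pairing f 0 = 0"
  by (rule additive_0) (rule shift_pairing_simps)

lemma shift_pairing_scaleC: "shift_pairing f (c *\<^sub>C p) = [:[:c:]:] * shift_pairing f p"
  by (induction p) (simp_all add: shift_pairing_0 shift_pairing_pCons scaleC_pCons
      cdual_apply_scaleC shift_subst_simps algebra_simps)

lemma shift_pairing_functional:
  "shift_pairing (f + g) p = shift_pairing f p + shift_pairing g p"
  "shift_pairing (c *\<^sub>C f) p = [:[:c:]:] * shift_pairing f p"
  "shift_pairing (\<partial> f) p = - ((mu - lam) * shift_pairing f p)"
proof (induction p)
  case 0
  { case 1 show ?case by (simp add: shift_pairing_0)
  next case 2 show ?case by (simp add: shift_pairing_0)
  next case 3 show ?case by (simp add: shift_pairing_0) }
next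
  case (pCons x p)
  { case 1 show ?case
      by (simp add: shift_pairing_pCons pCons.IH cdual_apply_simps(2) shift_subst_simps(1) distrib_left)
  next case 2 show ?case
      by (simp add: shift_pairing_pCons pCons.IH cdual_apply_simps(3) shift_subst_simps(2) algebra_simps)
  next case 3 show ?case
      unfolding shift_pairing_pCons pCons.IH cdual_apply_simps(5) shift_subst_simps(3) shift_subst_minus
      by (simp add: algebra_simps) }
qed

lemma shift_pairing_eq_subst2:
  "shift_pairing f q = subst2 ((*) lam) ((*) (mu - lam)) (\<lambda>c. [:[:c:]:]) (map_poly (cdual_apply f) q)"
proof -
  have "cdual_apply f 0 = 0" by (rule additive_0) (rule cdual_apply_add)
  then show ?thesis
    unfolding subst2_def shift_pairing_def shift_subst_def
    by (subst subst_op_map_poly) simp_all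
qed

lemma shift_pairing_neg_subst:
  "shift_pairing f (neg_subst q) =
    subst2 ((*) (- mu)) ((*) (mu - lam)) (\<lambda>c. [:[:c:]:]) (map_poly (cdual_apply f) q)"
proof -
  have "cdual_apply f 0 = 0" by (rule additive_0) (rule cdual_apply_add)
  moreover have "shift_pairing f (neg_subst q) =
      subst_op ((*) (- mu)) (\<lambda>x. shift_pairing f [:x:]) q"
    unfolding neg_subst_eq by (rule subst_op_hom) (simp_all add: shift_pairing_simps)
  ultimately show ?thesis
    unfolding subst2_def shift_pairing_simps shift_subst_def
    by (subst subst_op_map_poly) simp_all
qed

section \<open>The dual action on a finitely generated module\<close>

locale finite_cd_module =
  fixes S :: "'a::cd_module set"
  assumes finite_S: "finite S" and span_S: "cd_module.span S = UNIV"
begin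

lemma dual_eval_dual_op:
  assumes "conformal_product (T :: 'a \<Rightarrow> 'a \<Rightarrow> 'a poly)"
  shows "dual_eval (dual_op (T a) f) b = shift_pairing f (T a b)"
  using coeff_dual_op[of "T a", OF _ _ finite_S span_S] assms
  by (simp add: poly_eq_iff[of "dual_eval _ _"] coeff_dual_eval conformal_product_def dual_pairing_eq[symmetric])

text \<open>Evaluations are additive in \<open>b\<close> and turn \<partial> into multiplication by
  \<mu>, so agreement on generators spreads to their span, and the values determine the
  polynomial.\<close>

lemma dual_op_eqI:
  assumes T: "conformal_product (T :: 'a \<Rightarrow> 'a \<Rightarrow> 'a poly)"
    and eq: "\<And>b. b \<in> S \<Longrightarrow> dual_eval p b = shift_pairing f (T a b)"
  shows "dual_op (T a) f = p"
proof (rule dual_eval_inject)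
  fix b
  let ?q = "dual_op (T a) f"
  \<comment> \<open>\<open>[:c:]\<close> is \<open>c\<close> read in the inner variable \<mu>,
    constant in \<lambda>.\<close>
  have pact: "dual_eval r (pact c x) = [:c:] * dual_eval r x" for r :: "'a cdual poly" and c x
    by (induction c) (simp_all add: pact_pCons dual_eval_arg additive_0[of "dual_eval r"] algebra_simps
        smult_add_left[symmetric])
  have "b \<in> cd_module.span S" by (simp add: span_S)
  then show "dual_eval ?q b = dual_eval p b"
  proof (induction rule: cd_module.span_induct_alt)
    case base
    show ?case by (simp add: additive_0[of "dual_eval _"] dual_eval_arg)
  next
    case (step c x y)
    then show ?case by (simp only: dual_eval_arg pact dual_eval_dual_op[OF T] eq)
  qed
qed

text \<open>Each identity is compared through \<open>dual_eval\<close>. In the last one, \<partial>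
  on \<open>f\<close> contributes \<open>-(\<mu>-\<lambda>)\<close>, the sum of
  \<open>-\<mu>\<close> for \<partial> and of \<lambda>.\<close>

lemma dual_op_simps:
  assumes T: "conformal_product (T :: 'a \<Rightarrow> 'a \<Rightarrow> 'a poly)"
  shows "dual_op (T (a + b)) f = dual_op (T a) f + dual_op (T b) f"
    "dual_op (T a) (f + g) = dual_op (T a) f + dual_op (T a) g"
    "dual_op (T (c *\<^sub>C a)) f = c *\<^sub>C dual_op (T a) f"
    "dual_op (T a) (c *\<^sub>C f) = c *\<^sub>C dual_op (T a) f"
    "dual_op (T (\<partial> a)) f = - pCons 0 (dual_op (T a) f)"
    "dual_op (T a) (\<partial> f) = \<partial> (dual_op (T a) f) + pCons 0 (dual_op (T a) f)"
proof -
  have lin: "T (a + b) x = T a x + T b x" "T (c *\<^sub>C a) x = c *\<^sub>C T a x"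
    "T (\<partial> a) x = - pCons 0 (T a x)" for x
    using T by (simp_all add: conformal_product_def clinear_iff)
  show "dual_op (T (a + b)) f = dual_op (T a) f + dual_op (T b) f"
    "dual_op (T a) (f + g) = dual_op (T a) f + dual_op (T a) g"
    "dual_op (T (c *\<^sub>C a)) f = c *\<^sub>C dual_op (T a) f"
    "dual_op (T a) (c *\<^sub>C f) = c *\<^sub>C dual_op (T a) f"
    "dual_op (T (\<partial> a)) f = - pCons 0 (dual_op (T a) f)"
    "dual_op (T a) (\<partial> f) = \<partial> (dual_op (T a) f) + pCons 0 (dual_op (T a) f)"
    by (rule dual_op_eqI[OF T]; simp add: dual_eval_simps dual_eval_dual_op[OF T] lin
      shift_pairing_simps shift_pairing_scaleC shift_pairing_minus shift_pairing_functional
      algebra_simps del: minus_pCons pCons_0_0)+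
qed

end

lemma pair_poly_simps:
  fixes p q :: "'a::cd_module poly" and x :: 'a
  defines "inl \<equiv> map_poly (\<lambda>x. (x, 0 :: 'b::cd_module))"
    and "inr \<equiv> map_poly (\<lambda>x. (0 :: 'b, x))"
  shows "inl (p + q) = inl p + inl q" "inl (c *\<^sub>C p) = c *\<^sub>C inl p" "inl (- p) = - inl p"
    "inl (p - q) = inl p - inl q"
    "inl (\<partial> p) = \<partial> (inl p)" "inl (pCons 0 p) = pCons 0 (inl p)" "inl (neg_op p) = neg_op (inl p)"
    "inl [:x:] = [:(x, 0):]"
    and "inr (p + q) = inr p + inr q" "inr (c *\<^sub>C p) = c *\<^sub>C inr p" "inr (- p) = - inr p"
    "inr (p - q) = inr p - inr q"
    "inr (\<partial> p) = \<partial> (inr p)" "inr (pCons 0 p) = pCons 0 (inr p)" "inr (neg_op p) = neg_op (inr p)"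
    "inr [:x:] = [:(0, x):]"
  by (simp_all add: inl_def inr_def poly_eq_iff coeff_map_poly zero_prod_def scaleC_prod_def
      cderiv_prod_def coeff_pCons neg_op_def split: nat.split)

lemma semidirect_product_eq:
  "semidirect_product prec succ x y =
    map_poly (\<lambda>x. (x, 0)) (star_product prec succ (fst x) (fst y)) +
    map_poly (\<lambda>h. (0, h)) (dual_op (right_op prec (fst x)) (snd y) +
      neg_subst (dual_op (left_op succ (fst y)) (snd x)))"
  by (simp add: semidirect_product_def split_beta)

lemma subst2_pCons:
  fixes A B :: "'m::ab_group_add \<Rightarrow> 'm" and j :: "'c::ab_group_add \<Rightarrow> 'm"
  assumes "\<And>x y. A (x + y) = A x + A y" "\<And>x y. B (x + y) = B x + B y"
    "\<And>x y. j (x + y) = j x + j y"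
  shows "subst2 A B j (pCons p F) = subst_op B j p + A (subst2 A B j F)"
  unfolding subst2_def by (intro subst_op_pCons subst_op_add assms)

lemma cdual_apply_0: "cdual_apply f 0 = 0"
  by (rule additive_0) (rule cdual_apply_add)

lemma cdual_apply_pact: "cdual_apply f (pact p x) = p * cdual_apply f x"
  by (induction p) (simp_all add: pact_pCons cdual_apply_0 cdual_apply_add cdual_apply_scaleC
      cdual_apply_cderiv)

section \<open>Expansion in dual bases\<close>

locale dual_bases =
  fixes n :: nat and e :: "nat \<Rightarrow> 'a::cd_module" and e_dual :: "nat \<Rightarrow> 'a cdual"
  assumes basis: "cd_basis n e"
    and dual: "\<And>i j. i \<in> {1..n} \<Longrightarrow> j \<in> {1..n} \<Longrightarrow>
      cdual_apply (e_dual j) (e i) = (if i = j then 1 else 0)"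
begin

sublocale finite_cd_module "e ` {1..n}"
  using basis by unfold_locales (simp_all add: cd_basis_def)

text \<open>The functional \<open>e_dual k\<close> reads off the coefficient of \<open>e k\<close>,
  so this is that coefficient of \<open>q\<close>, with \<lambda> outside and the inner variable
  standing for \<partial>.\<close>

definition coords :: "'a poly \<Rightarrow> nat \<Rightarrow> complex poly poly" where
  "coords q k = map_poly (cdual_apply (e_dual k)) q"

lemma basis_expansion: "x = (\<Sum>k = 1..n. pact (cdual_apply (e_dual k) x) (e k))"
proof -
  have "x \<in> cd_module.span (e ` {1..n})" by (simp only: span_S UNIV_I)
  then show ?thesis
  proof (induction rule: cd_module.span_induct_alt)
    case base
    show ?case by (simp add: cdual_apply_0)
  next
    case (step c x y)
    then obtain m where m: "m \<in> {1..n}" "x = e m" by blast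
    have "(\<Sum>k = 1..n. pact (cdual_apply (e_dual k) (pact c x)) (e k)) =
        (\<Sum>k = 1..n. if k = m then pact c (e m) else 0)"
      using m by (intro sum.cong) (auto simp: cdual_apply_pact dual)
    also have "\<dots> = pact c x" using m by simp
    finally show ?case using step(2)
      by (simp add: cdual_apply_add pact_add_left sum.distrib)
  qed
qed

lemma basis_expansion_poly:
  "q = (\<Sum>k = 1..n. subst2 (pCons 0) \<partial> (\<lambda>c. [:c *\<^sub>C e k:]) (coords q k))"
proof (induction q)
  case 0
  show ?case by (simp add: coords_def subst2_def)
next
  case (pCons x q)
  have "subst_op \<partial> (\<lambda>c. [:c *\<^sub>C e k:]) p = [:pact p (e k):]" for k p
    unfolding pact_def by (subst subst_op_hom[of "\<lambda>x. [:x:]" \<partial> \<partial>]) (simp_all add: cderiv_pCons)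
  then have "subst2 (pCons 0) \<partial> (\<lambda>c. [:c *\<^sub>C e k:]) (coords (pCons x q) k) =
      [:pact (cdual_apply (e_dual k) x) (e k):] +
      pCons 0 (subst2 (pCons 0) \<partial> (\<lambda>c. [:c *\<^sub>C e k:]) (coords q k))" for k
    by (simp add: coords_def map_poly_pCons cdual_apply_0 subst2_pCons cderiv_add scaleC_add_left)
  then have "(\<Sum>k = 1..n. subst2 (pCons 0) \<partial> (\<lambda>c. [:c *\<^sub>C e k:]) (coords (pCons x q) k)) =
      (\<Sum>k = 1..n. [:pact (cdual_apply (e_dual k) x) (e k):]) + pCons 0 q"
    using arg_cong[OF pCons.IH, of "pCons 0"]
    by (simp only: sum.distrib additive_sum[of "pCons 0", OF pCons_0_add])
  also have "(\<Sum>k = 1..n. [:pact (cdual_apply (e_dual k) x) (e k):]) = [:x:]"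
    by (subst additive_sum[of "\<lambda>x. [:x:]", symmetric], simp) (simp only: basis_expansion[symmetric])
  finally show ?case by simp
qed

text \<open>Evaluation at \<open>e m\<close> kills each \<open>e_dual k\<close> with
  \<open>k \<noteq> m\<close>; in the surviving summand \<open>A\<close> and \<open>B\<close> have
  become \<open>A'\<close> and \<open>B'\<close>. The form with \<open>b\<close> in the generating
  set fits \<open>dual_op_eqI\<close>.\<close>

lemma dual_eval_expansion:
  assumes b: "b \<in> e ` {1..n}"
    and A: "\<And>p m. dual_eval (A p) (e m) = A' (dual_eval p (e m))"
    and B: "\<And>p m. dual_eval (B p) (e m) = B' (dual_eval p (e m))"
    and zero: "A' 0 = 0" "B' 0 = 0"
  shows "\<exists>m\<in>{1..n}. b = e m \<and>
    dual_eval (\<Sum>k = 1..n. subst2 A B (\<lambda>c. [:c *\<^sub>C e_dual k:]) (F k)) b =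
    subst2 A' B' (\<lambda>c. [:[:c:]:]) (F m)"
proof -
  obtain m where m: "m \<in> {1..n}" "b = e m" using b by blast
  have "dual_eval (\<Sum>k = 1..n. subst2 A B (\<lambda>c. [:c *\<^sub>C e_dual k:]) (F k)) (e m) =
      (\<Sum>k = 1..n. subst2 A' B' (\<lambda>c. dual_eval [:c *\<^sub>C e_dual k:] (e m)) (F k))"
    unfolding additive_sum[of "\<lambda>p. dual_eval p (e m)", OF dual_eval_simps(1)]
    by (intro sum.cong refl subst2_hom[of "\<lambda>p. dual_eval p (e m)"] dual_eval_simps(1) A B)
  also have "\<dots> = (\<Sum>k = 1..n. if k = m then subst2 A' B' (\<lambda>c. [:[:c:]:]) (F m) else 0)"
    using m by (intro sum.cong) (auto simp: dual_eval_simps cdual_apply_simps dual subst2_eq_0 zero)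
  also have "\<dots> = subst2 A' B' (\<lambda>c. [:[:c:]:]) (F m)" using m by simp
  finally show ?thesis using m by blast
qed

end

section \<open>Structure constants of the semidirect product\<close>

locale conformal_products_basis = dual_bases n e e_dual
  for n :: nat and e :: "nat \<Rightarrow> 'a::cd_module" and e_dual :: "nat \<Rightarrow> 'a cdual" +
  fixes prec succ :: "'a \<Rightarrow> 'a \<Rightarrow> 'a poly"
  assumes prec: "conformal_product prec" and succ: "conformal_product succ"
begin

abbreviation "sd_mult \<equiv> semidirect_product prec succ"

text \<open>This makes \<open>bullet_sum\<close> available. In the right action
  \<open>neg_subst\<close> exchanges \<lambda> and \<open>-\<lambda>-\<partial>\<close>, which gives
  the functional the rule of a first argument and the element of \<open>A\<close> that of a
  second.\<close>

lemma conformal_product_semidirect: "conformal_product sd_mult"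
proof -
  note R = dual_op_simps[OF conformal_product_right_op[OF prec]]
  note L = dual_op_simps[OF conformal_product_left_op[OF succ]]
  note star = conformal_product_star[OF prec succ, unfolded conformal_product_def clinear_iff]
  show ?thesis
    unfolding conformal_product_def clinear_iff semidirect_product_eq
    using star
    by (simp add: scaleC_prod_def cderiv_prod_def R L pair_poly_simps neg_subst_simps
        neg_subst_scaleC neg_subst_minus scaleC_add_right cderiv_add pCons_0_add pCons_0_minus
        pCons_0_diff neg_op_def cderiv_minus cderiv_diff del: minus_pCons add_pCons diff_pCons)
qed

text \<open>The structure constants: \<open>e\<^sub>i \<succ>\<^sub>\<lambda> e\<^sub>j = \<Sum>\<^sub>k P i j k (\<lambda>, \<partial>) e\<^sub>k\<close>, and \<open>Q\<close> for \<open>\<prec>\<close>.\<close>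

definition P :: "nat \<Rightarrow> nat \<Rightarrow> nat \<Rightarrow> complex poly poly" where
  "P i j k = coords (succ (e i) (e j)) k"

definition Q :: "nat \<Rightarrow> nat \<Rightarrow> nat \<Rightarrow> complex poly poly" where
  "Q i j k = coords (prec (e i) (e j)) k"

text \<open>The value at \<open>e k\<close> is \<open>P i k j\<close> at
  \<open>(\<lambda>, \<mu>-\<lambda>)\<close>, and \<open>\<mu>-\<lambda>\<close> is
  \<open>-\<lambda>-\<partial>\<close> on the dual.\<close>

lemma dual_left_op:
  "dual_op (left_op succ (e i)) (e_dual j) =
    (\<Sum>k = 1..n. subst2 (pCons 0) neg_op (\<lambda>c. [:c *\<^sub>C e_dual k:]) (P i k j))"
proof (rule dual_op_eqI[OF conformal_product_left_op[OF succ]])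
  fix b assume b: "b \<in> e ` {1..n}"
  from dual_eval_expansion[OF b, of "pCons 0" "(*) lam" neg_op "(*) (mu - lam)" "\<lambda>k. P i k j"]
  show "dual_eval (\<Sum>k = 1..n. subst2 (pCons 0) neg_op (\<lambda>c. [:c *\<^sub>C e_dual k:]) (P i k j)) b =
      shift_pairing (e_dual j) (left_op succ (e i) b)"
    by (auto simp: dual_eval_simps shift_pairing_eq_subst2 left_op_def P_def coords_def)
qed

text \<open>The value at \<open>e k\<close> is \<open>Q k i j\<close> at
  \<open>(-\<mu>, \<mu>-\<lambda>)\<close>; on the dual these two are \<partial> and
  \<open>-\<lambda>-\<partial>\<close>.\<close>

lemma dual_right_op:
  "dual_op (right_op prec (e i)) (e_dual j) =
    (\<Sum>k = 1..n. subst2 \<partial> neg_op (\<lambda>c. [:c *\<^sub>C e_dual k:]) (Q k i j))"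
proof (rule dual_op_eqI[OF conformal_product_right_op[OF prec]])
  fix b assume b: "b \<in> e ` {1..n}"
  from dual_eval_expansion[OF b, of \<partial> "(*) (- mu)" neg_op "(*) (mu - lam)" "\<lambda>k. Q k i j"]
  show "dual_eval (\<Sum>k = 1..n. subst2 \<partial> neg_op (\<lambda>c. [:c *\<^sub>C e_dual k:]) (Q k i j)) b =
      shift_pairing (e_dual j) (right_op prec (e i) b)"
    by (auto simp: dual_eval_simps shift_pairing_neg_subst right_op_def Q_def coords_def)
qed

definition E :: "nat \<Rightarrow> 'a \<times> 'a cdual" where "E i = (e i, 0)"
definition F :: "nat \<Rightarrow> 'a \<times> 'a cdual" where "F i = (0, e_dual i)"

lemma dual_op_0:
  assumes "conformal_product (T :: 'a \<Rightarrow> 'a \<Rightarrow> 'a poly)"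
  shows "dual_op (T 0) f = 0" "dual_op (T a) 0 = 0"
  using additive_0[of "\<lambda>a. dual_op (T a) f"] additive_0[of "dual_op (T a)"] dual_op_simps[OF assms]
  by blast+

lemma neg_subst_0: "neg_subst 0 = 0"
  by (rule additive_0) (rule neg_subst_simps)

text \<open>The third equation follows from \<open>dual_left_op\<close> since
  \<open>neg_subst\<close> takes \<open>(\<lambda>, -\<lambda>-\<partial>)\<close> to
  \<open>(-\<lambda>-\<partial>, \<lambda>)\<close>; in the fourth no component in \<open>A\<close>
  is left to act.\<close>

lemma prod_basis:
  "sd_mult (E i) (E j) =
    (\<Sum>k = 1..n. subst2 (pCons 0) \<partial> (\<lambda>c. [:c *\<^sub>C E k:]) (P i j k)) +
    (\<Sum>k = 1..n. subst2 (pCons 0) \<partial> (\<lambda>c. [:c *\<^sub>C E k:]) (Q i j k))"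
  "sd_mult (E i) (F j) = (\<Sum>k = 1..n. subst2 \<partial> neg_op (\<lambda>c. [:c *\<^sub>C F k:]) (Q k i j))"
  "sd_mult (F j) (E i) = (\<Sum>k = 1..n. subst2 neg_op (pCons 0) (\<lambda>c. [:c *\<^sub>C F k:]) (P i k j))"
  "sd_mult (F i) (F j) = 0"
proof -
  have star_0: "star_product prec succ 0 b = 0" "star_product prec succ a 0 = 0" for a b
    using conformal_product_star[OF prec succ]
      clinear_0[of "star_product prec succ a"] clinear_0[of "\<lambda>a. star_product prec succ a b"]
    by (simp_all add: conformal_product_def)
  note 0 = star_0 neg_subst_0 dual_op_0[OF conformal_product_right_op[OF prec]]
    dual_op_0[OF conformal_product_left_op[OF succ]]
  have inl: "map_poly (\<lambda>x. (x, 0)) (\<Sum>k = 1..n. subst2 (pCons 0) \<partial> (\<lambda>c. [:c *\<^sub>C e k:]) (G k)) =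
      (\<Sum>k = 1..n. subst2 (pCons 0) \<partial> (\<lambda>c. [:c *\<^sub>C E k:]) (G k))" for G
    unfolding additive_sum[of "map_poly (\<lambda>x. (x, 0))", OF pair_poly_simps(1)]
    by (intro sum.cong refl, subst subst2_hom)
      (rule pair_poly_simps | simp add: pair_poly_simps E_def scaleC_prod_def)+
  \<comment> \<open>The operators stay arbitrary because the two mixed products use different
    pairs.\<close>
  have inr: "map_poly (\<lambda>x. (0, x)) (\<Sum>k = 1..n. subst2 A B (\<lambda>c. [:c *\<^sub>C e_dual k:]) (G k)) =
      (\<Sum>k = 1..n. subst2 A' B' (\<lambda>c. [:c *\<^sub>C F k:]) (G k))"
    if "\<And>p :: 'a cdual poly. map_poly (\<lambda>x. (0 :: 'a, x)) (A p) = A' (map_poly (\<lambda>x. (0, x)) p)"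
      "\<And>p :: 'a cdual poly. map_poly (\<lambda>x. (0 :: 'a, x)) (B p) = B' (map_poly (\<lambda>x. (0, x)) p)"
    for A B A' B' G
    unfolding additive_sum[of "map_poly (\<lambda>x. (0, x))", OF pair_poly_simps(9)]
    by (intro sum.cong refl, subst subst2_hom[of _ A A' B B'])
      (rule pair_poly_simps that | simp add: pair_poly_simps F_def scaleC_prod_def)+
  have "star_product prec succ (e i) (e j) =
    (\<Sum>k = 1..n. subst2 (pCons 0) \<partial> (\<lambda>c. [:c *\<^sub>C e k:]) (P i j k)) +
    (\<Sum>k = 1..n. subst2 (pCons 0) \<partial> (\<lambda>c. [:c *\<^sub>C e k:]) (Q i j k))"
    unfolding P_def Q_def basis_expansion_poly[symmetric] by (simp add: star_product_def)
  then show "sd_mult (E i) (E j) =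
    (\<Sum>k = 1..n. subst2 (pCons 0) \<partial> (\<lambda>c. [:c *\<^sub>C E k:]) (P i j k)) +
    (\<Sum>k = 1..n. subst2 (pCons 0) \<partial> (\<lambda>c. [:c *\<^sub>C E k:]) (Q i j k))"
    by (simp add: semidirect_product_eq E_def[of i] E_def[of j] 0 pair_poly_simps inl del: One_nat_def)
  show "sd_mult (E i) (F j) = (\<Sum>k = 1..n. subst2 \<partial> neg_op (\<lambda>c. [:c *\<^sub>C F k:]) (Q k i j))"
    by (simp add: semidirect_product_eq E_def[of i] F_def[of j] 0 dual_right_op del: One_nat_def)
      (rule inr; rule pair_poly_simps)
  have "neg_subst (dual_op (left_op succ (e i)) (e_dual j)) =
      (\<Sum>k = 1..n. subst2 neg_op (pCons 0) (\<lambda>c. [:c *\<^sub>C e_dual k:]) (P i k j))"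
    unfolding dual_left_op additive_sum[of neg_subst, OF neg_subst_simps(1)]
    by (intro sum.cong refl, subst subst2_hom[of neg_subst _ neg_op _ "pCons 0"])
      (simp_all add: neg_subst_simps)
  then show "sd_mult (F j) (E i) = (\<Sum>k = 1..n. subst2 neg_op (pCons 0) (\<lambda>c. [:c *\<^sub>C F k:]) (P i k j))"
    by (simp add: semidirect_product_eq E_def[of i] F_def[of j] 0 del: One_nat_def)
      (rule inr; rule pair_poly_simps)
  show "sd_mult (F i) (F j) = 0"
    by (simp add: semidirect_product_eq F_def 0)
qed

text \<open>In use, \<open>j\<close> places the product in one tensor factor, \<open>d\<close> is
  \<partial> on that factor and \<open>T\<close> replaces the variable.\<close>

lemma subst_prod_basis:
  fixes j :: "'a \<times> 'a cdual \<Rightarrow> 'n::complex_vector"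
  assumes T: "\<And>x y. T (x + y) = T x + T y" and j: "clinear j"
    and d: "\<And>x y. d (x + y) = d x + d y"
    and j_d: "\<And>x. j (\<partial> x) = d (j x)" and T_d: "\<And>x. T (d x) = d (T x)"
  shows
    "subst_op T j (sd_mult (E a) (E b)) =
      (\<Sum>k = 1..n. subst2 T d (\<lambda>c. c *\<^sub>C j (E k)) (P a b k)) +
      (\<Sum>k = 1..n. subst2 T d (\<lambda>c. c *\<^sub>C j (E k)) (Q a b k))"
    "subst_op T j (sd_mult (E a) (F b)) =
      (\<Sum>k = 1..n. subst2 d (\<lambda>x. - T x - d x) (\<lambda>c. c *\<^sub>C j (F k)) (Q k a b))"
    "subst_op T j (sd_mult (F b) (E a)) =
      (\<Sum>k = 1..n. subst2 (\<lambda>x. - T x - d x) T (\<lambda>c. c *\<^sub>C j (F k)) (P a k b))"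
proof -
  note h = subst_op_operators[where T = T and j = j and d = d, OF T clinear_add[OF j] d j_d T_d]
  have *: "subst_op T j (\<Sum>k = 1..n. subst2 A B (\<lambda>c. [:c *\<^sub>C v k:]) (G k)) =
      (\<Sum>k = 1..n. subst2 A' B' (\<lambda>c. c *\<^sub>C j (v k)) (G k))"
    if "\<And>p. subst_op T j (A p) = A' (subst_op T j p)"
      "\<And>p. subst_op T j (B p) = B' (subst_op T j p)" for A B A' B' G v
    unfolding additive_sum[of "subst_op T j", OF h(1)]
    by (intro sum.cong refl, subst subst2_hom[of "subst_op T j" A A' B B'])
      (rule h that | simp add: h clinear_scaleC[OF j])+
  show "subst_op T j (sd_mult (E a) (E b)) =
      (\<Sum>k = 1..n. subst2 T d (\<lambda>c. c *\<^sub>C j (E k)) (P a b k)) +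
      (\<Sum>k = 1..n. subst2 T d (\<lambda>c. c *\<^sub>C j (E k)) (Q a b k))"
    unfolding prod_basis h(1) by (intro arg_cong2[where f = "(+)"] *; rule h)
  show "subst_op T j (sd_mult (E a) (F b)) =
      (\<Sum>k = 1..n. subst2 d (\<lambda>x. - T x - d x) (\<lambda>c. c *\<^sub>C j (F k)) (Q k a b))"
    unfolding prod_basis by (rule *; rule h)
  show "subst_op T j (sd_mult (F b) (E a)) =
      (\<Sum>k = 1..n. subst2 (\<lambda>x. - T x - d x) T (\<lambda>c. c *\<^sub>C j (F k)) (P a k b))"
    unfolding prod_basis by (rule *; rule h)
qed

end

section \<open>The Yang-Baxter equation\<close>

definition cong_total :: "'b::cd_module tensor3 \<Rightarrow> 'b tensor3 \<Rightarrow> bool" where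
  "cong_total x y \<longleftrightarrow> x - y \<in> range d_total"

lemma d_total_0: "d_total 0 = 0"
  by (rule additive_0) (rule d_total_add)

text \<open>The operators \<open>d1\<close>, \<open>d2\<close>, \<open>d3\<close> commute, so each
  maps the image of \<open>d_total\<close> into itself.\<close>

lemma range_d_total:
  fixes x y :: "'b::cd_module tensor3"
  shows "0 \<in> range (d_total :: 'b tensor3 \<Rightarrow> _)"
  "x \<in> range d_total \<Longrightarrow> y \<in> range d_total \<Longrightarrow> x + y \<in> range d_total"
  "x \<in> range d_total \<Longrightarrow> y \<in> range d_total \<Longrightarrow> x - y \<in> range d_total"
  "x \<in> range d_total \<Longrightarrow> d1 x \<in> range d_total"
  "x \<in> range d_total \<Longrightarrow> d2 x \<in> range d_total"
  "x \<in> range d_total \<Longrightarrow> d3 x \<in> range d_total"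
proof -
  show "0 \<in> range (d_total :: 'b tensor3 \<Rightarrow> _)" using d_total_0 by (metis rangeI)
  show "x \<in> range d_total \<Longrightarrow> y \<in> range d_total \<Longrightarrow> x + y \<in> range d_total"
    "x \<in> range d_total \<Longrightarrow> y \<in> range d_total \<Longrightarrow> x - y \<in> range d_total"
    by (auto simp: d_total_add[symmetric] additive_diff[of d_total, OF d_total_add, symmetric])
  have "d1 (d_total t) = d_total (d1 t)" "d2 (d_total t) = d_total (d2 t)"
    "d3 (d_total t) = d_total (d3 t)" for t :: "'b tensor3"
    by (simp_all add: d_total_def d_add d_commute)
  then show "x \<in> range d_total \<Longrightarrow> d1 x \<in> range d_total"
    "x \<in> range d_total \<Longrightarrow> d2 x \<in> range d_total"
    "x \<in> range d_total \<Longrightarrow> d3 x \<in> range d_total"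
    by auto
qed

lemma cong_total_refl: "cong_total x x"
  by (simp add: cong_total_def range_d_total)

lemma cong_total_add: "cong_total x x' \<Longrightarrow> cong_total y y' \<Longrightarrow> cong_total (x + y) (x' + y')"
  and cong_total_diff: "cong_total x x' \<Longrightarrow> cong_total y y' \<Longrightarrow> cong_total (x - y) (x' - y')"
  unfolding cong_total_def add_diff_add diff_diff_swap by (simp_all add: range_d_total)

lemma cong_total_sum: "(\<And>i. i \<in> I \<Longrightarrow> cong_total (f i) (g i)) \<Longrightarrow> cong_total (\<Sum>i\<in>I. f i) (\<Sum>i\<in>I. g i)"
  unfolding cong_total_def sum_subtractf[symmetric]
  by (induction I rule: infinite_finite_induct) (simp_all add: range_d_total)

lemma d_minus:
  "d1 (- t) = - d1 t" "d2 (- t) = - d2 t" "d3 (- t) = - d3 t"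
  by (rule additive_uminus; rule d_add)+

text \<open>Each difference is \<open>d_total (- t)\<close>. The three forms arise with the product
  in the second, third and first factor respectively.\<close>

lemma cong_total_operators:
  "cong_total (- d1 t - d2 t) (d3 t)"
  "cong_total (- d1 t - d3 t) (d2 t)"
  "cong_total (- d2 t - d1 t) (d3 t)"
  unfolding cong_total_def by (rule range_eqI[of _ _ "- t"]; simp add: d_total_def d_minus)+

text \<open>\<open>subst_op_cong_mod\<close> is applied to the inner and then to the outer variable;
  the targets preserve the image of \<open>d_total\<close>.\<close>

lemma cong_total_subst2:
  fixes A B A' B' :: "'b::cd_module tensor3 \<Rightarrow> 'b tensor3"
  assumes A: "\<And>x y. A (x + y) = A x + A y" and B: "\<And>x y. B (x + y) = B x + B y"
    and A': "A' \<in> {d1, d2, d3}" and B': "B' \<in> {d1, d2, d3}"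
    and eq: "\<And>t. cong_total (A t) (A' t)" "\<And>t. cong_total (B t) (B' t)"
  shows "cong_total (subst2 A B (\<lambda>c. c *\<^sub>C w) F) (subst2 A' B' (\<lambda>c. c *\<^sub>C w) F)"
proof -
  have add: "D (x + y) = D x + D y" and W: "x \<in> range d_total \<Longrightarrow> D x \<in> range d_total"
    if "D \<in> {d1, d2, d3}" for D :: "'b tensor3 \<Rightarrow> 'b tensor3" and x y
    using that by (auto simp: d_add range_d_total)
  show ?thesis
    unfolding cong_total_def subst2_def
    by (intro subst_op_cong_mod subst_op_add A B add[OF A'] add[OF B'] W[OF A'] W[OF B']
        range_d_total(1,2) eq[unfolded cong_total_def] scaleC_add_left)
      (simp_all add: range_d_total)
qed

section \<open>Products of basis vectors inside the threefold tensor product\<close>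

context conformal_products_basis
begin

abbreviation sum3 :: "(nat \<Rightarrow> nat \<Rightarrow> nat \<Rightarrow> 'n::comm_monoid_add) \<Rightarrow> 'n" where
  "sum3 f \<equiv> \<Sum>i = 1..n. \<Sum>j = 1..n. \<Sum>k = 1..n. f i j k"

lemma sum3_permute:
  fixes f :: "nat \<Rightarrow> nat \<Rightarrow> nat \<Rightarrow> 'n::comm_monoid_add"
  shows "sum3 (\<lambda>i j k. f i k j) = sum3 f" "sum3 (\<lambda>i j k. f k i j) = sum3 f"
    "sum3 (\<lambda>i j k. f k j i) = sum3 f"
proof -
  show *: "sum3 (\<lambda>i j k. f i k j) = sum3 f" for f :: "nat \<Rightarrow> nat \<Rightarrow> nat \<Rightarrow> 'n"
    by (rule sum.cong[OF refl]) (rule sum.swap)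
  have **: "sum3 (\<lambda>i j k. f j i k) = sum3 f" for f :: "nat \<Rightarrow> nat \<Rightarrow> nat \<Rightarrow> 'n"
    by (rule sum.swap)
  show "sum3 (\<lambda>i j k. f k i j) = sum3 f"
    using *[of "\<lambda>i j k. f j i k"] **[of f] by simp
  show "sum3 (\<lambda>i j k. f k j i) = sum3 f"
    using *[of "\<lambda>i j k. f j k i"] **[of "\<lambda>i j k. f i k j"] *[of f] by simp
qed

text \<open>Here \<open>-T-d\<close> is congruent to \<open>d2\<close>.\<close>

lemmas subst_third = subst_prod_basis[where T = d1 and d = d3 and j = "\<lambda>x. u \<otimes> v \<otimes> x" for u v,
    OF d_add(1) clinear_tensors(4) d_add(3) d_tensor(3)[symmetric] d_commute(2)]

lemma neg_d12_add: "- (d1 (x + y) + d2 (x + y)) = - (d1 x + d2 x) + - (d1 y + d2 y)"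
  by (simp add: d_add)

lemma neg_d12_commute: "- (d1 (d2 x) + d2 (d2 x)) = d2 (- (d1 x + d2 x))"
  by (simp add: d_add d_minus d_commute additive_diff[of d2, OF d_add(2)])

text \<open>Here \<open>T\<close> is congruent to \<open>d3\<close>, while \<open>-T-d\<close>
  equals \<open>d1\<close> exactly.\<close>

lemmas subst_second = subst_prod_basis[where T = "\<lambda>t. - (d1 t + d2 t)" and d = d2
    and j = "\<lambda>x. u \<otimes> x \<otimes> y" for u y,
    OF neg_d12_add clinear_tensors(3) d_add(2) d_tensor(2)[symmetric] neg_d12_commute]

text \<open>Here \<open>-T-d\<close> is congruent to \<open>d3\<close>.\<close>

lemmas subst_first = subst_prod_basis[where T = d2 and d = d1 and j = "\<lambda>x. x \<otimes> z \<otimes> y" for z y,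
    OF d_add(2) clinear_tensors(1) d_add(1) d_tensor(1)[symmetric] d_commute(1)[symmetric]]

text \<open>The tensors to which the three products in \<open>r \<bullet> r\<close> reduce modulo \<open>\<partial>\<^bsup>\<otimes>3\<^esup>\<close>, sorted by the
  position of the factor in \<open>A\<close>.\<close>

definition total_first where
  "total_first G = sum3 (\<lambda>i j k. subst2 d2 d1 (\<lambda>c. c *\<^sub>C (E k \<otimes> F i \<otimes> F j)) (G i j k))"
definition total_second where
  "total_second G = sum3 (\<lambda>i j k. subst2 d3 d2 (\<lambda>c. c *\<^sub>C (F i \<otimes> E k \<otimes> F j)) (G j i k))"
definition total_third where
  "total_third G = sum3 (\<lambda>i j k. subst2 d1 d3 (\<lambda>c. c *\<^sub>C (F i \<otimes> F j \<otimes> E k)) (G i j k))"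

abbreviation sum2 :: "(nat \<Rightarrow> nat \<Rightarrow> 'n::comm_monoid_add) \<Rightarrow> 'n" where
  "sum2 f \<equiv> \<Sum>i = 1..n. \<Sum>j = 1..n. f i j"

lemma terms_first:
  "cong_total (sum2 (\<lambda>i j. subst_op d2 (\<lambda>c. c \<otimes> F i \<otimes> F j) (sd_mult (E i) (E j))))
    (total_first P + total_first Q)"
  "cong_total (sum2 (\<lambda>i j. subst_op (\<lambda>t. - (d1 t + d2 t)) (\<lambda>c. E i \<otimes> c \<otimes> F j) (sd_mult (E j) (F i))))
    (total_first Q)"
  "cong_total (sum2 (\<lambda>i j. subst_op d1 (\<lambda>c. E i \<otimes> F j \<otimes> c) (sd_mult (F i) (E j))))
    (total_first P)"
proof -
  show "cong_total (sum2 (\<lambda>i j. subst_op d2 (\<lambda>c. c \<otimes> F i \<otimes> F j) (sd_mult (E i) (E j))))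
    (total_first P + total_first Q)"
    unfolding subst_first total_first_def sum.distrib by (rule cong_total_refl)
  show "cong_total (sum2 (\<lambda>i j. subst_op (\<lambda>t. - (d1 t + d2 t)) (\<lambda>c. E i \<otimes> c \<otimes> F j) (sd_mult (E j) (F i))))
    (total_first Q)"
    unfolding subst_second total_first_def
    by (subst sum3_permute(3)[symmetric])
      (intro cong_total_sum cong_total_subst2; simp add: d_add cong_total_refl cong_total_operators)
  show "cong_total (sum2 (\<lambda>i j. subst_op d1 (\<lambda>c. E i \<otimes> F j \<otimes> c) (sd_mult (F i) (E j))))
    (total_first P)"
    unfolding subst_third total_first_def
    \<comment> \<open>The summand carries \<open>P j k i\<close>, the inverse of the cycle in
      \<open>sum3_permute(2)\<close>, hence two applications.\<close>
    by (subst sum3_permute(2)[symmetric], subst sum3_permute(2)[symmetric])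
      (intro cong_total_sum cong_total_subst2; simp add: d_add cong_total_refl cong_total_operators)
qed

text \<open>The middle term of \<open>r \<bullet> r\<close> multiplies in the order
  \<open>E j\<close>, \<open>E i\<close>; this is the source of the indices \<open>G j i k\<close>
  in \<open>total_second\<close>.\<close>

lemma terms_second:
  "cong_total (sum2 (\<lambda>i j. subst_op d1 (\<lambda>c. F i \<otimes> E j \<otimes> c) (sd_mult (E i) (F j))))
    (total_second Q)"
  "cong_total (sum2 (\<lambda>i j. subst_op (\<lambda>t. - (d1 t + d2 t)) (\<lambda>c. F i \<otimes> c \<otimes> F j) (sd_mult (E j) (E i))))
    (total_second P + total_second Q)"
  "cong_total (sum2 (\<lambda>i j. subst_op d2 (\<lambda>c. c \<otimes> E i \<otimes> F j) (sd_mult (F i) (E j))))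
    (total_second P)"
proof -
  show "cong_total (sum2 (\<lambda>i j. subst_op d1 (\<lambda>c. F i \<otimes> E j \<otimes> c) (sd_mult (E i) (F j))))
    (total_second Q)"
    unfolding subst_third total_second_def
    by (subst sum3_permute(1)[symmetric])
      (intro cong_total_sum cong_total_subst2; simp add: d_add cong_total_refl cong_total_operators)
  show "cong_total (sum2 (\<lambda>i j. subst_op (\<lambda>t. - (d1 t + d2 t)) (\<lambda>c. F i \<otimes> c \<otimes> F j) (sd_mult (E j) (E i))))
    (total_second P + total_second Q)"
    unfolding subst_second total_second_def sum.distrib[symmetric]
    by (intro cong_total_sum cong_total_add cong_total_subst2; simp add: d_add cong_total_refl cong_total_operators)
  show "cong_total (sum2 (\<lambda>i j. subst_op d2 (\<lambda>c. c \<otimes> E i \<otimes> F j) (sd_mult (F i) (E j))))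
    (total_second P)"
    unfolding subst_first total_second_def
    by (subst sum3_permute(3)[symmetric])
      (intro cong_total_sum cong_total_subst2; simp add: d_add cong_total_refl cong_total_operators)
qed

lemma terms_third:
  "cong_total (sum2 (\<lambda>i j. subst_op d2 (\<lambda>c. c \<otimes> F i \<otimes> E j) (sd_mult (E i) (F j))))
    (total_third Q)"
  "cong_total (sum2 (\<lambda>i j. subst_op d1 (\<lambda>c. F i \<otimes> F j \<otimes> c) (sd_mult (E i) (E j))))
    (total_third P + total_third Q)"
  "cong_total (sum2 (\<lambda>i j. subst_op (\<lambda>t. - (d1 t + d2 t)) (\<lambda>c. F i \<otimes> c \<otimes> E j) (sd_mult (F j) (E i))))
    (total_third P)"
proof -
  show "cong_total (sum2 (\<lambda>i j. subst_op d2 (\<lambda>c. c \<otimes> F i \<otimes> E j) (sd_mult (E i) (F j))))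
    (total_third Q)"
    unfolding subst_first total_third_def
    by (subst sum3_permute(2)[symmetric])
      (intro cong_total_sum cong_total_subst2; simp add: d_add cong_total_refl cong_total_operators)
  show "cong_total (sum2 (\<lambda>i j. subst_op d1 (\<lambda>c. F i \<otimes> F j \<otimes> c) (sd_mult (E i) (E j))))
    (total_third P + total_third Q)"
    unfolding subst_third total_third_def sum.distrib by (rule cong_total_refl)
  show "cong_total (sum2 (\<lambda>i j. subst_op (\<lambda>t. - (d1 t + d2 t)) (\<lambda>c. F i \<otimes> c \<otimes> E j) (sd_mult (F j) (E i))))
    (total_third P)"
    unfolding subst_second total_third_def
    by (subst sum3_permute(1)[symmetric])
      (intro cong_total_sum cong_total_subst2; simp add: d_add cong_total_refl cong_total_operators)
qed

lemma tensor_minus_left: "(- a) \<otimes> b = - (a \<otimes> b)"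
  by (rule additive_uminus) (rule tensor_add_left)

lemma acybe_solution_basis: "acybe_solution sd_mult (\<Sum>i = 1..n. E i \<otimes> F i - F i \<otimes> E i)"
proof -
  \<comment> \<open>The boolean separates the two kinds of pure tensors in \<open>r\<close>, the
    sign sitting on the first factor, so that one index set suffices for
    \<open>bullet_sum\<close>.\<close>
  let ?I = "{1..n} \<times> (UNIV :: bool set)"
  let ?r = "\<lambda>(i, b). if b then E i else - F i" and ?l = "\<lambda>(i, b). if b then F i else E i"
  have split: "(\<Sum>x\<in>?I. f x) = (\<Sum>i = 1..n. f (i, True) + f (i, False))" for f :: "_ \<Rightarrow> 'n::comm_monoid_add"
    by (subst sum.cartesian_product[symmetric, of "\<lambda>i b. f (i, b)", simplified]) (simp add: UNIV_bool add.commute)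
  have r: "(\<Sum>i = 1..n. E i \<otimes> F i - F i \<otimes> E i) = (\<Sum>x\<in>?I. ?r x \<otimes> ?l x)"
    unfolding split by (simp add: tensor_minus_left)
  have neg: "bullet_term sd_mult (- u) x v y = - bullet_term sd_mult u x v y"
    "bullet_term sd_mult u x (- v) y = - bullet_term sd_mult u x v y" for u x v y
    by (rule additive_uminus[of "\<lambda>u. bullet_term sd_mult u x v y"]
        additive_uminus[of "\<lambda>v. bullet_term sd_mult u x v y"];
        rule clinear_bullet_term[OF conformal_product_semidirect, THEN clinear_add])+
  \<comment> \<open>Three of the twelve products multiply two dual vectors and vanish.\<close>
  have FF: "subst_op T j (sd_mult (F a) (F b)) = 0"
    if "clinear j" for T and j :: "_ \<Rightarrow> 'm::complex_vector" and a b
    by (simp add: prod_basis clinear_0[OF that])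
  have "bullet sd_mult (\<Sum>i = 1..n. E i \<otimes> F i - F i \<otimes> E i) =
     sum2 (\<lambda>i j. bullet_term sd_mult (E i) (F i) (E j) (F j) - bullet_term sd_mult (E i) (F i) (F j) (E j)
        - bullet_term sd_mult (F i) (E i) (E j) (F j) + bullet_term sd_mult (F i) (E i) (F j) (E j))"
    unfolding r bullet_sum[OF conformal_product_semidirect]
    unfolding split
    by (simp add: neg sum.distrib sum_subtractf algebra_simps sum_negf)
  \<comment> \<open>The nine remaining products are grouped by the position of the factor in
    \<open>A\<close>.\<close>
  also have "\<dots> =
     (sum2 (\<lambda>i j. subst_op d2 (\<lambda>c. c \<otimes> F i \<otimes> F j) (sd_mult (E i) (E j)))
      - sum2 (\<lambda>i j. subst_op (\<lambda>t. - (d1 t + d2 t)) (\<lambda>c. E i \<otimes> c \<otimes> F j) (sd_mult (E j) (F i)))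
      - sum2 (\<lambda>i j. subst_op d1 (\<lambda>c. E i \<otimes> F j \<otimes> c) (sd_mult (F i) (E j)))) +
     (sum2 (\<lambda>i j. subst_op (\<lambda>t. - (d1 t + d2 t)) (\<lambda>c. F i \<otimes> c \<otimes> F j) (sd_mult (E j) (E i)))
      - sum2 (\<lambda>i j. subst_op d1 (\<lambda>c. F i \<otimes> E j \<otimes> c) (sd_mult (E i) (F j)))
      - sum2 (\<lambda>i j. subst_op d2 (\<lambda>c. c \<otimes> E i \<otimes> F j) (sd_mult (F i) (E j)))) +
     (sum2 (\<lambda>i j. subst_op d1 (\<lambda>c. F i \<otimes> F j \<otimes> c) (sd_mult (E i) (E j)))
      - sum2 (\<lambda>i j. subst_op d2 (\<lambda>c. c \<otimes> F i \<otimes> E j) (sd_mult (E i) (F j)))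
      - sum2 (\<lambda>i j. subst_op (\<lambda>t. - (d1 t + d2 t)) (\<lambda>c. F i \<otimes> c \<otimes> E j) (sd_mult (F j) (E i))))"
    unfolding bullet_term_def FF[OF clinear_tensors(4)] FF[OF clinear_tensors(3)] FF[OF clinear_tensors(1)]
      sum.distrib sum_subtractf sum.neutral_const
    by (simp only: algebra_simps add_0_left)
  \<comment> \<open>Each group cancels identically, so \<open>r \<bullet> r\<close> is congruent to
    0.\<close>
  finally have "cong_total (bullet sd_mult (\<Sum>i = 1..n. E i \<otimes> F i - F i \<otimes> E i))
      (total_first P + total_first Q - total_first Q - total_first P +
        (total_second P + total_second Q - total_second Q - total_second P) +
        (total_third P + total_third Q - total_third Q - total_third P))"
    by (simp only:) (intro cong_total_add[OF cong_total_add] cong_total_diff[OF cong_total_diff]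
        terms_first terms_second terms_third)
  then show ?thesis by (simp add: acybe_solution_def cong_total_def)
qed

end

theorem theorem6p15:
  fixes prec succ :: "'a::cd_module \<Rightarrow> 'a \<Rightarrow> 'a poly"
    and n :: nat and e :: "nat \<Rightarrow> 'a" and e_dual :: "nat \<Rightarrow> 'a cdual"
  assumes "dendriform_conformal_algebra prec succ"
    and "cd_basis n e"
    and "\<And>i j. i \<in> {1..n} \<Longrightarrow> j \<in> {1..n} \<Longrightarrow>
      cdual_apply (e_dual j) (e i) = (if i = j then 1 else 0)"
  shows "acybe_solution (semidirect_product prec succ)
    (\<Sum>i = 1..n. (e i, 0) \<otimes> (0, e_dual i) - (0, e_dual i) \<otimes> (e i, 0))"
proof -
  interpret conformal_products_basis n e e_dual prec succ
    using assms by unfold_locales (simp_all add: dendriform_conformal_algebra_def)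
  show ?thesis using acybe_solution_basis by (simp only: E_def F_def)
qed

end
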